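(* Let $\Gamma$ be a simple graph on $V=\{1,\dots,n\}$ with edge ideal $I\subseteq k[x_1,\dots,x_n]$, let $t\ge 1$ be an integer, and let $F$ be a cover of $\Gamma$ with $\operatorname{core}(F)\ne\emptyset$. Then $P_F$ is an embedded associated prime ideal of $I^t$ if and only if there exists $\mathbf a\in\mathbb N^n$ such that $F$ is minimal among the covers of $\Gamma$ containing $N[V_{\mathbf a}]$, the weighted graph $\Gamma_{\mathbf a}$ is $t$-saturating, and $\nu(\Gamma_{\mathbf a}-N_{\mathbf a}(i))\ge t-\deg_{\mathbf a}(i)$ for all $i\in\operatorname{core}(F)\setminus V_{\mathbf a}$.
   Context: $k$ is a field, $n\ge 1$. The edge ideal of $\Gamma$ is the ideal $I$ generated by the $x_ix_j$ with $\{i,j\}$ an edge of $\Gamma$. A cover of $\Gamma$ is a set of vertices meeting every edge. For $F\subseteq V$, $P_F$ is the ideal generated by the variables $x_i$, $i\in F$, and $\operatorname{core}(F)$ is the set of vertices in $F$ not adjacent to any vertex of $V\setminus F$. Embedded associated prime means non-minimal associated prime. For $U\subseteq V$, $N[U]$ is the union of $U$ and the set of vertices adjacent to some vertex of $U$ (closed neighborhood). "$F$ is minimal among the covers containing $N$" means that $F$ is a cover containing $N$ and no proper subset of $F$ is a cover containing $N$. A weighted graph is a simple graph (its base graph) whose vertices are assigned positive integers, called weights. A matching of a weighted graph $\Omega$ is a family of edges (not necessarily different) such that every vertex of $\Omega$ appears in these edges no more times than its weight. The matching number $\nu(\Omega)$ is the maximal number of edges (counted with multiplicity) of a matching of $\Omega$.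 For a set $N$ of vertices, $\Omega-N$ is the induced weighted subgraph on the vertices not in $N$. A weighted graph $\Omega$ on vertex set $U$ is $t$-saturating if $\nu(\Omega)<t$ and $\nu(\Omega-N_\Omega(i))\ge t-\deg_\Omega(i)$ for all $i\in U$, where $N_\Omega(i)$ is the set of vertices adjacent to $i$ in $\Omega$ and $\deg_\Omega(i)$ is the sum of the weights of the vertices of $N_\Omega(i)$. For $\mathbf a\in\mathbb N^n$ let $V_{\mathbf a}=\{i\in V\mid a_i>0\}$; $\Gamma_{\mathbf a}$ is the weighted graph whose base graph is the subgraph of $\Gamma$ induced on $V_{\mathbf a}$ and where $i\in V_{\mathbf a}$ has weight $a_i$. For any $i\in V$, $N_{\mathbf a}(i)$ is the set of vertices of $V_{\mathbf a}$ adjacent to $i$ in $\Gamma$, and $\deg_{\mathbf a}(i)=\sum_{j\in N_{\mathbf a}(i)}a_j$. *)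

theory Defs
  imports
    "HOL-Library.Poly_Mapping"
    "HOL-Library.Multiset"
    "HOL-Algebra.Ideal_Product"
    "HOL-Algebra.Algebraic_Closure_Type"
begin

section \<open>Polynomial rings and associated primes\<close>

text \<open>
  Polynomials with coefficients in \<open>'k\<close> in the variables \<open>x\<^sub>i\<close>, where \<open>i\<close> ranges over the type
  \<open>'v\<close>: finitely supported maps from exponent vectors to coefficients, with convolution as product.
  For a finite type \<open>'v\<close> with \<open>n\<close> elements this is \<open>k[x\<^sub>1,\<dots>,x\<^sub>n]\<close>.
\<close>
type_synonym ('v, 'k) mpoly = "('v \<Rightarrow>\<^sub>0 nat) \<Rightarrow>\<^sub>0 'k"

abbreviation mpoly_ring :: "('v, 'k::field) mpoly ring"
  where "mpoly_ring \<equiv> ring_of_type_algebra"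

definition var :: "'v \<Rightarrow> ('v, 'k::field) mpoly"
  where "var i = Poly_Mapping.single (Poly_Mapping.single i 1) 1"

definition variable_ideal :: "'v set \<Rightarrow> ('v, 'k::field) mpoly set"
  where "variable_ideal F = genideal mpoly_ring (var ` F)"

text \<open>
  \<open>ideals_set R\<close> is the semiring of ideals of \<open>R\<close> with the product of ideals as multiplication and
  \<open>R\<close> itself as unit, so this is the usual power of an ideal.
\<close>
definition ideal_power :: "('a, 'b) ring_scheme \<Rightarrow> 'a set \<Rightarrow> nat \<Rightarrow> 'a set"
  where "ideal_power R I t = I [^]\<^bsub>ideals_set R\<^esub> t"

definition ideal_colon :: "('a, 'b) ring_scheme \<Rightarrow> 'a set \<Rightarrow> 'a \<Rightarrow> 'a set"
  where "ideal_colon R J f = {r \<in> carrier R. r \<otimes>\<^bsub>R\<^esub> f \<in> J}"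

text \<open>
  The colon ideal \<open>J : f\<close> is the annihilator of the residue class of \<open>f\<close> in \<open>R/J\<close>; the associated
  primes of the ideal \<open>J\<close> are those of the module \<open>R/J\<close>.
\<close>
definition associated_primes :: "('a, 'b) ring_scheme \<Rightarrow> 'a set \<Rightarrow> 'a set set"
  where "associated_primes R J =
    {P. primeideal P R \<and> (\<exists>f\<in>carrier R. P = ideal_colon R J f)}"

definition embedded_associated_primes :: "('a, 'b) ring_scheme \<Rightarrow> 'a set \<Rightarrow> 'a set set"
  where "embedded_associated_primes R J =
    {P \<in> associated_primes R J. \<exists>Q\<in>associated_primes R J. Q \<subset> P}"


section \<open>Simple graphs, given by their vertex set and their edge set\<close>

definition simple_graph :: "'v set \<Rightarrow> 'v set set \<Rightarrow> bool"
  where "simple_graph V E \<longleftrightarrow> finite V \<and> (\<forall>e\<in>E. e \<subseteq> V \<and> card e = 2)"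

definition edge_ideal :: "'v set set \<Rightarrow> ('v, 'k::field) mpoly set"
  where "edge_ideal E = genideal mpoly_ring {var i * var j | i j. {i, j} \<in> E}"

definition cover :: "'v set set \<Rightarrow> 'v set \<Rightarrow> bool"
  where "cover E C \<longleftrightarrow> (\<forall>e\<in>E. e \<inter> C \<noteq> {})"

text \<open>Here and in the theorem the vertex set of the graph is the whole type \<open>'v\<close>.\<close>
definition core :: "'v set set \<Rightarrow> 'v set \<Rightarrow> 'v set"
  where "core E F = {i \<in> F. \<not> (\<exists>j \<in> UNIV - F. {i, j} \<in> E)}"

definition closed_nbhd :: "'v set set \<Rightarrow> 'v set \<Rightarrow> 'v set"
  where "closed_nbhd E U = U \<union> {j. \<exists>i\<in>U. {i, j} \<in> E}"

definition minimal_cover_containing :: "'v set set \<Rightarrow> 'v set \<Rightarrow> 'v set \<Rightarrow> bool"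
  where "minimal_cover_containing E N F \<longleftrightarrow>
    cover E F \<and> N \<subseteq> F \<and> \<not> (\<exists>C. C \<subset> F \<and> cover E C \<and> N \<subseteq> C)"


section \<open>Weighted graphs\<close>

text \<open>The values of \<open>weight\<close> outside \<open>verts\<close> are irrelevant.\<close>
record 'v wgraph =
  verts :: "'v set"
  edges :: "'v set set"
  weight :: "'v \<Rightarrow> nat"

definition weighted_graph :: "'v wgraph \<Rightarrow> bool"
  where "weighted_graph \<Omega> \<longleftrightarrow>
    simple_graph (verts \<Omega>) (edges \<Omega>) \<and> (\<forall>i\<in>verts \<Omega>. 0 < weight \<Omega> i)"

definition matching :: "'v wgraph \<Rightarrow> 'v set multiset \<Rightarrow> bool"
  where "matching \<Omega> M \<longleftrightarrow>
    set_mset M \<subseteq> edges \<Omega> \<and> (\<forall>i\<in>verts \<Omega>. size {#e \<in># M. i \<in> e#} \<le> weight \<Omega> i)"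

definition matching_number :: "'v wgraph \<Rightarrow> nat"
  where "matching_number \<Omega> = Max {size M | M. matching \<Omega> M}"

definition remove_verts :: "'v wgraph \<Rightarrow> 'v set \<Rightarrow> 'v wgraph"
  where "remove_verts \<Omega> N =
    \<lparr>verts = verts \<Omega> - N, edges = {e \<in> edges \<Omega>. e \<inter> N = {}}, weight = weight \<Omega>\<rparr>"

definition nbhd :: "'v wgraph \<Rightarrow> 'v \<Rightarrow> 'v set"
  where "nbhd \<Omega> i = {j \<in> verts \<Omega>. {i, j} \<in> edges \<Omega>}"

definition wdegree :: "'v wgraph \<Rightarrow> 'v \<Rightarrow> nat"
  where "wdegree \<Omega> i = (\<Sum>j\<in>nbhd \<Omega> i. weight \<Omega> j)"

definition saturating :: "nat \<Rightarrow> 'v wgraph \<Rightarrow> bool"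
  where "saturating t \<Omega> \<longleftrightarrow>
    matching_number \<Omega> < t \<and>
    (\<forall>i\<in>verts \<Omega>.
      int (matching_number (remove_verts \<Omega> (nbhd \<Omega> i))) \<ge> int t - int (wdegree \<Omega> i))"

definition pos_verts :: "('v \<Rightarrow> nat) \<Rightarrow> 'v set"
  where "pos_verts a = {i. a i > 0}"

definition graph_of :: "'v set set \<Rightarrow> ('v \<Rightarrow> nat) \<Rightarrow> 'v wgraph"
  where "graph_of E a =
    \<lparr>verts = pos_verts a, edges = {e \<in> E. e \<subseteq> pos_verts a}, weight = a\<rparr>"

text \<open>
  Unlike \<open>nbhd (graph_of E a) i\<close> and \<open>wdegree (graph_of E a) i\<close>, the following are meant for
  every vertex \<open>i\<close> of the original graph, also for those with \<open>a i = 0\<close>.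
\<close>
definition nbhd_of :: "'v set set \<Rightarrow> ('v \<Rightarrow> nat) \<Rightarrow> 'v \<Rightarrow> 'v set"
  where "nbhd_of E a i = {j \<in> pos_verts a. {i, j} \<in> E}"

definition degree_of :: "'v set set \<Rightarrow> ('v \<Rightarrow> nat) \<Rightarrow> 'v \<Rightarrow> nat"
  where "degree_of E a i = (\<Sum>j\<in>nbhd_of E a i. a j)"

lemma weighted_graph_graph_of:
  fixes E :: "'v::finite set set"
  assumes "simple_graph UNIV E"
  shows "weighted_graph (graph_of E a)"
  using assms by (auto simp: weighted_graph_def simple_graph_def graph_of_def pos_verts_def)

lemma weighted_graph_remove_verts:
  assumes "weighted_graph \<Omega>"
  shows "weighted_graph (remove_verts \<Omega> N)"
  using assms by (auto simp: weighted_graph_def simple_graph_def remove_verts_def)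

text \<open>The maximum in the definition of the matching number is taken over a finite nonempty set.\<close>

lemma size_le_sum_incidences:
  assumes "finite V" and "\<forall>e\<in>#M. e \<inter> V \<noteq> {}"
  shows "size M \<le> (\<Sum>i\<in>V. size {#e \<in># M. i \<in> e#})"
  using assms(2)
proof (induction M)
  case empty
  then show ?case by simp
next
  case (add e M)
  then obtain v where v: "v \<in> V" "v \<in> e" by auto
  have "(\<Sum>i\<in>V. size {#e' \<in># M. i \<in> e'#}) + 1
      \<le> (\<Sum>i\<in>V. size {#e' \<in># M. i \<in> e'#}) + (\<Sum>i\<in>V. if i \<in> e then 1 else 0)"
    using member_le_sum[of v V "\<lambda>i. if i \<in> e then 1 else (0::nat)"] v assms(1) by simp
  also have "\<dots> = (\<Sum>i\<in>V. size {#e' \<in># add_mset e M. i \<in> e'#})"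
    unfolding sum.distrib[symmetric] by (intro sum.cong) auto
  finally show ?case using add by simp
qed

lemma matching_sizes:
  assumes "weighted_graph \<Omega>"
  shows "finite {size M | M. matching \<Omega> M}" and "{size M | M. matching \<Omega> M} \<noteq> {}"
proof -
  have "size M \<le> (\<Sum>i\<in>verts \<Omega>. weight \<Omega> i)" if M: "matching \<Omega> M" for M
  proof -
    have "\<forall>e\<in>#M. e \<inter> verts \<Omega> \<noteq> {}"
    proof
      fix e assume "e \<in># M"
      then have "e \<subseteq> verts \<Omega>" "card e = 2"
        using M assms by (auto simp: matching_def weighted_graph_def simple_graph_def)
      then show "e \<inter> verts \<Omega> \<noteq> {}" by (metis card.empty inf.orderE zero_neq_numeral)
    qed
    then have "size M \<le> (\<Sum>i\<in>verts \<Omega>. size {#e \<in># M. i \<in> e#})"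
      using assms by (intro size_le_sum_incidences) (auto simp: weighted_graph_def simple_graph_def)
    also have "\<dots> \<le> (\<Sum>i\<in>verts \<Omega>. weight \<Omega> i)"
      using M by (intro sum_mono) (auto simp: matching_def)
    finally show ?thesis .
  qed
  then show "finite {size M | M. matching \<Omega> M}"
    by (auto intro: finite_subset[of _ "{..(\<Sum>i\<in>verts \<Omega>. weight \<Omega> i)}"])
  have "matching \<Omega> {#}" by (simp add: matching_def)
  then show "{size M | M. matching \<Omega> M} \<noteq> {}" by blast
qed

end

theory Submission
  imports Defs
begin

text \<open>
  A monomial lies in \<open>I\<^sup>t\<close> iff its exponent vector \<open>b\<close> admits a matching with \<open>t\<close> edges, and \<open>P\<^sub>F\<close> is
  associated to \<open>I\<^sup>t\<close> iff it is the annihilator of the class of some monomial \<open>x\<^sup>b\<close>. It is then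
  automatically embedded: as \<open>core F\<close> is not empty, \<open>F\<close> properly contains a minimal cover.

  Given \<open>a\<close>, take \<open>b = a\<close> on \<open>F\<close> and \<open>b = t\<close> off \<open>F\<close>. The conditions on \<open>a\<close> say that powers of all
  \<open>x\<^sub>i\<close> with \<open>i \<in> F\<close> annihilate \<open>x\<^sup>b\<close> modulo \<open>I\<^sup>t\<close> while no monomial in the other variables does;
  multiplying \<open>x\<^sup>b\<close> by a maximal surviving monomial in the variables of \<open>F\<close> gives an exponent as wanted.

  Conversely, given \<open>b\<close>, let \<open>a\<close> be its restriction to \<open>core F\<close> and \<open>d\<close> the sum of \<open>b\<close> over \<open>F - core F\<close>.
  Vertices of the latter set can be matched outside \<open>F\<close>, so \<open>a\<close> has the required properties with
  \<open>t - d\<close> in place of \<open>t\<close>. To raise \<open>t - d\<close> to \<open>t\<close> one adds edges to \<open>a\<close>: there is an edge \<open>{p, q}\<close>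
  such that both \<open>p\<close> and \<open>q\<close> are missed by maximum matchings, and increasing \<open>a\<close> by one at \<open>p\<close> and \<open>q\<close>
  raises the matching number by exactly one.
\<close>

section \<open>Multiset matchings\<close>

definition mdeg :: "'v set multiset \<Rightarrow> 'v \<Rightarrow> nat"
  where "mdeg M i = size {#e \<in># M. i \<in> e#}"

text \<open>Weights become capacities that may be zero. A vertex of capacity zero is as good as
  removed, so induced weighted subgraphs need no separate notion.\<close>

definition has_matching :: "'v set set \<Rightarrow> ('v \<Rightarrow> nat) \<Rightarrow> nat \<Rightarrow> bool"
  where "has_matching E b t \<longleftrightarrow> (\<exists>M. set_mset M \<subseteq> E \<and> size M = t \<and> (\<forall>i. mdeg M i \<le> b i))"

lemma mdeg_empty [simp]: "mdeg {#} i = 0"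
  by (simp add: mdeg_def)

lemma mdeg_add_mset [simp]: "mdeg (add_mset e M) i = mdeg M i + of_bool (i \<in> e)"
  by (simp add: mdeg_def)

lemma mdeg_union [simp]: "mdeg (M + N) i = mdeg M i + mdeg N i"
  by (simp add: mdeg_def)

lemma mdeg_replicate [simp]: "mdeg (replicate_mset k e) i = k * of_bool (i \<in> e)"
  by (induction k) auto

lemma mdeg_mono: "M \<subseteq># N \<Longrightarrow> mdeg M i \<le> mdeg N i"
  by (metis mdeg_union mset_subset_eq_exists_conv le_add1)

lemma mdeg_pos_iff: "0 < mdeg M i \<longleftrightarrow> (\<exists>e\<in>#M. i \<in> e)"
  by (induction M) auto

lemma has_matchingI:
  assumes "set_mset M \<subseteq> E" "size M = t" "\<And>i. mdeg M i \<le> b i"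
  shows "has_matching E b t"
  using assms by (auto simp: has_matching_def)

lemma has_matchingE:
  assumes "has_matching E b t"
  obtains M where "set_mset M \<subseteq> E" "size M = t" "\<And>i. mdeg M i \<le> b i"
  using assms by (auto simp: has_matching_def)

lemma mset_subset_of_size: "s \<le> size M \<Longrightarrow> \<exists>N. N \<subseteq># M \<and> size N = s"
proof (induction M)
  case (add x M)
  show ?case
  proof (cases "s = Suc (size M)")
    case False
    then obtain N where "N \<subseteq># M" "size N = s" using add by auto
    then show ?thesis by (intro exI[of _ N]) (auto simp: subseteq_mset_def le_SucI)
  qed (auto intro: exI[of _ "add_mset x M"])
qed simp

lemma mdeg_pos_edge:
  assumes "0 < mdeg M p" "\<forall>e\<in>#M. card e = 2"
  obtains x N where "x \<noteq> p" "M = add_mset {p, x} N"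
proof -
  from assms(1) obtain e where e: "e \<in># M" "p \<in> e" by (auto simp: mdeg_pos_iff)
  with assms(2) have "card e = 2" by auto
  then obtain x where "e = {p, x}" "x \<noteq> p"
    using e(2) by (auto simp: card_2_iff)
  with e show thesis by (metis that insert_DiffM)
qed

lemma has_matching_mono:
  assumes "has_matching E b t" "\<And>i. b i \<le> c i" "s \<le> t"
  shows "has_matching E c s"
proof -
  from assms(1) obtain M where M: "set_mset M \<subseteq> E" "size M = t" "\<And>i. mdeg M i \<le> b i"
    by (auto simp: has_matching_def)
  obtain N where N: "N \<subseteq># M" "size N = s"
    using mset_subset_of_size assms(3) M(2) by blast
  then have "set_mset N \<subseteq> E" using M(1) set_mset_mono by blast
  moreover have "mdeg N i \<le> c i" for i
    using mdeg_mono[OF N(1), of i] M(3)[of i] assms(2)[of i] by simp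
  ultimately show ?thesis using N(2) by (auto simp: has_matching_def)
qed

text \<open>\<open>A0\<close> and \<open>B0\<close> are the two classes of edges of an alternating walk from \<open>p\<close> to \<open>r\<close>.\<close>

lemma alternating_exchange:
  assumes "\<forall>e\<in>#A. card e = 2" "\<forall>e\<in>#B. card e = 2" "mdeg A p < mdeg B p"
  shows "\<exists>A0 B0 r. A0 \<subseteq># A \<and> B0 \<subseteq># B \<and>
    (size B0 = Suc (size A0) \<and> (\<forall>x. mdeg B0 x = mdeg A0 x + of_bool (x = p) + of_bool (x = r))
        \<and> mdeg A r + of_bool (r = p) < mdeg B r
     \<or> size B0 = size A0 \<and> (\<forall>x. mdeg B0 x + of_bool (x = r) = mdeg A0 x + of_bool (x = p))
        \<and> mdeg B r < mdeg A r)"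
  using assms
proof (induction "size A + size B" arbitrary: A B p rule: less_induct)
  case less
  obtain x B1 where x: "x \<noteq> p" and B: "B = add_mset {p, x} B1"
    using less.prems by (metis mdeg_pos_edge gr_implies_not0 not_gr0)
  show ?case
  proof (cases "mdeg A x < mdeg B x")
    \<comment> \<open>The walk stops at \<open>x\<close> after the single edge
      \<open>{p, x}\<close>, since \<open>B\<close> has the excess there.\<close>
    case True
    then show ?thesis
      using x by (intro exI[of _ "{#}"] exI[of _ "{#{p, x}#}"] exI[of _ x]) (auto simp: B)
  next
    case False
    \<comment> \<open>At \<open>x\<close> it is \<open>A\<close> that has the excess over
      \<open>B1\<close>, so the walk continues with the roles of the two multisets
      exchanged.\<close>
    then have "mdeg B1 x < mdeg A x" by (simp add: B)
    then obtain B0 A0 r where sub: "B0 \<subseteq># B1" "A0 \<subseteq># A" and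
      c: "size A0 = Suc (size B0) \<and> (\<forall>y. mdeg A0 y = mdeg B0 y + of_bool (y = x) + of_bool (y = r))
            \<and> mdeg B1 r + of_bool (r = x) < mdeg A r
          \<or> size A0 = size B0 \<and> (\<forall>y. mdeg A0 y + of_bool (y = r) = mdeg B0 y + of_bool (y = x))
            \<and> mdeg A r < mdeg B1 r"
      using less.hyps[of B1 A x] less.prems B by (auto simp: add.commute)
    have sub': "add_mset {p, x} B0 \<subseteq># B" using sub(1) B by simp
    from c show ?thesis
    proof (elim disjE conjE)
      assume *: "size A0 = Suc (size B0)"
        "\<forall>y. mdeg A0 y = mdeg B0 y + of_bool (y = x) + of_bool (y = r)"
        "mdeg B1 r + of_bool (r = x) < mdeg A r"
      \<comment> \<open>Even without \<open>{p, x}\<close>, the degree of \<open>B1\<close> at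
        \<open>p\<close> is at least that of \<open>A\<close>, so the walk cannot end there with an
        edge of \<open>A\<close>.\<close>
      have "r \<noteq> p" using *(3) less.prems(3) x by (auto simp: B)
      then have "mdeg B r < mdeg A r" using * by (auto simp: B)
      then show ?thesis using * sub sub' x
        by (intro exI[of _ A0] exI[of _ "add_mset {p, x} B0"] exI[of _ r]) auto
    next
      assume *: "size A0 = size B0"
        "\<forall>y. mdeg A0 y + of_bool (y = r) = mdeg B0 y + of_bool (y = x)"
        "mdeg A r < mdeg B1 r"
      have "mdeg A r + of_bool (r = p) < mdeg B r" using * by (auto simp: B)
      moreover have "mdeg (add_mset {p, x} B0) y = mdeg A0 y + of_bool (y = p) + of_bool (y = r)" for y
        using *(2)[rule_format, of y] x by (auto split: if_splits)
      ultimately show ?thesis using * sub sub'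
        by (intro exI[of _ A0] exI[of _ "add_mset {p, x} B0"] exI[of _ r]) auto
    qed
  qed
qed

text \<open>Interchanging the two edge classes of an alternating walk keeps the sum of both degrees
  at every vertex and changes single degrees only at the ends. In case \<open>both\<close> the walk
  has odd length and one edge passes from \<open>N\<close> to \<open>M\<close>; in case
  \<open>swap\<close> it has even length. The inequality at \<open>r\<close> keeps the raised degree
  there within the larger of the two old degrees.\<close>

lemma matching_exchange:
  assumes "\<forall>e\<in>E. card e = 2" "set_mset M \<subseteq> E" "set_mset N \<subseteq> E" "mdeg M p < mdeg N p"
  obtains (both) M' N' r where "set_mset M' \<subseteq> E" "set_mset N' \<subseteq> E"
      "size M' = size M + 1" "size N' + 1 = size N"
      "\<And>x. mdeg M' x = mdeg M x + of_bool (x = p) + of_bool (x = r)"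
      "\<And>x. mdeg N' x + of_bool (x = p) + of_bool (x = r) = mdeg N x"
      "mdeg M r + of_bool (r = p) < mdeg N r"
  | (swap) M' N' r where "set_mset M' \<subseteq> E" "set_mset N' \<subseteq> E"
      "size M' = size M" "size N' = size N"
      "\<And>x. mdeg M' x + of_bool (x = r) = mdeg M x + of_bool (x = p)"
      "\<And>x. mdeg N' x + of_bool (x = p) = mdeg N x + of_bool (x = r)"
      "mdeg N r < mdeg M r"
proof -
  have "\<forall>e\<in>#M. card e = 2" "\<forall>e\<in>#N. card e = 2" using assms by auto
  from alternating_exchange[OF this assms(4)]
  obtain A0 B0 r where sub: "A0 \<subseteq># M" "B0 \<subseteq># N" and
    c: "size B0 = Suc (size A0) \<and> (\<forall>x. mdeg B0 x = mdeg A0 x + of_bool (x = p) + of_bool (x = r))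
          \<and> mdeg M r + of_bool (r = p) < mdeg N r
        \<or> size B0 = size A0 \<and> (\<forall>x. mdeg B0 x + of_bool (x = r) = mdeg A0 x + of_bool (x = p))
          \<and> mdeg N r < mdeg M r"
    by blast
  obtain M1 N1 where M: "M = A0 + M1" and N: "N = B0 + N1"
    using sub by (auto simp: mset_subset_eq_exists_conv)
  have set: "set_mset (B0 + M1) \<subseteq> E" "set_mset (A0 + N1) \<subseteq> E" using assms M N by auto
  from c show thesis
  proof (elim disjE conjE)
    assume *: "size B0 = Suc (size A0)"
      "\<forall>x. mdeg B0 x = mdeg A0 x + of_bool (x = p) + of_bool (x = r)"
      "mdeg M r + of_bool (r = p) < mdeg N r"
    show thesis by (rule both[of "B0 + M1" "A0 + N1" r]) (use set * M N in auto)
  next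
    assume *: "size B0 = size A0"
      "\<forall>x. mdeg B0 x + of_bool (x = r) = mdeg A0 x + of_bool (x = p)"
      "mdeg N r < mdeg M r"
    show thesis
    proof (rule swap[of "B0 + M1" "A0 + N1" r])
      fix x
      show "mdeg (B0 + M1) x + of_bool (x = r) = mdeg M x + of_bool (x = p)"
        using *(2)[rule_format, of x] M by simp
      show "mdeg (A0 + N1) x + of_bool (x = p) = mdeg N x + of_bool (x = r)"
        using *(2)[rule_format, of x] N by simp
    qed (use set * M N in auto)
  qed
qed

text \<open>A matching that profits from the extra unit at \<open>p\<close> uses it, hence contains
  an edge \<open>{p, x}\<close>. Deleting this edge leaves \<open>k\<close> edges that fit
  \<open>a\<close> and leave one unit at \<open>x\<close> free.\<close>

lemma has_matching_inc:
  assumes "\<forall>e\<in>E. card e = 2" "has_matching E (a(p := Suc (a p))) (Suc k)" "\<not> has_matching E a (Suc k)"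
  obtains x where "{p, x} \<in> E" "x \<noteq> p" "0 < a x" "has_matching E (a(x := a x - 1)) k"
proof -
  obtain M where M: "set_mset M \<subseteq> E" "size M = Suc k" "\<And>i. mdeg M i \<le> (a(p := Suc (a p))) i"
    using assms(2) by (auto simp: has_matching_def)
  have "mdeg M p = Suc (a p)"
  proof (rule ccontr)
    assume "mdeg M p \<noteq> Suc (a p)"
    then have "mdeg M i \<le> a i" for i using M(3)[of i] by (auto split: if_splits)
    then show False using assms(3) M by (auto simp: has_matching_def)
  qed
  moreover have "\<forall>e\<in>#M. card e = 2" using assms(1) M(1) by auto
  ultimately obtain x N where x: "x \<noteq> p" "M = add_mset {p, x} N"
    using mdeg_pos_edge[of M p] by auto
  have "0 < a x" using M(3)[of x] x by auto
  moreover have "mdeg N i \<le> (a(x := a x - 1)) i" for i using M(3)[of i] x by (auto split: if_splits)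
  then have "has_matching E (a(x := a x - 1)) k" using M x by (intro has_matchingI[of N]) auto
  ultimately show thesis using that x M(1) by auto
qed

lemma has_matching_add_edge:
  assumes "has_matching E a k" "{p, q} \<in> E" "p \<noteq> q"
  shows "has_matching E (a(p := Suc (a p), q := Suc (a q))) (Suc k)"
proof -
  obtain M where M: "set_mset M \<subseteq> E" "size M = k" "\<And>i. mdeg M i \<le> a i"
    using assms(1) by (auto simp: has_matching_def)
  then show ?thesis unfolding has_matching_def
    by (intro exI[of _ "add_mset {p, q} M"]) (use assms in auto)
qed

text \<open>Deleting a single edge at \<open>p\<close> brings the matching back below
  \<open>a\<close>, so one more unit of capacity gains at most one edge.\<close>

lemma not_has_matching_inc:
  assumes "\<forall>e\<in>E. card e = 2" "\<not> has_matching E a (Suc k)"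
  shows "\<not> has_matching E (a(p := Suc (a p))) (Suc (Suc k))"
proof
  assume *: "has_matching E (a(p := Suc (a p))) (Suc (Suc k))"
  have "\<not> has_matching E a (Suc (Suc k))" using assms(2) has_matching_mono by fastforce
  from has_matching_inc[OF assms(1) * this] obtain x where "has_matching E (a(x := a x - 1)) (Suc k)" .
  then show False using assms(2) has_matching_mono[of E _ "Suc k" a "Suc k"] by force
qed

text \<open>
  Write \<open>f(i, j)\<close> for the matching number of \<open>a\<close> increased by \<open>i\<close> at \<open>p\<close> and by \<open>j\<close> at \<open>q\<close>. With
  \<open>f(-1, 0) = f(0, -1) = f(0, 0) = k\<close>, the assumption \<open>f(1, 1) = k + 2\<close> leads to \<open>f(-1, 1) = f(1, -1) = k + 1\<close>
  by an exchange between the points \<open>(-1, 0)\<close> and \<open>(1, 1)\<close>; an exchange between \<open>(-1, 1)\<close> and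
  \<open>(1, -1)\<close> is then contradictory.
\<close>

lemma shifted_matching:
  assumes E: "\<forall>e\<in>E. card e = 2" and pq: "p \<noteq> q"
    and M: "has_matching E (a(p := a p - 1)) k" and a: "0 < a p" "\<not> has_matching E a (Suc k)"
    and N: "has_matching E (a(p := Suc (a p), q := Suc (a q))) (Suc (Suc k))"
  shows "has_matching E (a(p := a p - 1, q := Suc (a q))) (Suc k)"
proof -
  obtain M where M: "set_mset M \<subseteq> E" "size M = k" "\<And>i. mdeg M i \<le> (a(p := a p - 1)) i"
    using M by (auto simp: has_matching_def)
  obtain N where N: "set_mset N \<subseteq> E" "size N = Suc (Suc k)"
    "\<And>i. mdeg N i \<le> (a(p := Suc (a p), q := Suc (a q))) i"
    using N by (auto simp: has_matching_def)
  have no: False if "set_mset L \<subseteq> E" "size L = Suc k" "\<And>i. mdeg L i \<le> a i" for L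
    using that a by (auto simp: has_matching_def)
  have no1: False if "set_mset L \<subseteq> E" "size L = Suc (Suc k)" "\<And>i. mdeg L i \<le> (a(x := Suc (a x))) i" for L x
    using that not_has_matching_inc[OF E a(2), of x] by (auto simp: has_matching_def)
  \<comment> \<open>If \<open>N\<close> did not exhaust both \<open>p\<close> and \<open>q\<close>,
    it would fit \<open>a\<close> increased at one vertex only, which holds at most
    \<open>k + 1\<close> edges.\<close>
  have Np: "mdeg N p = Suc (a p)"
    using no1[OF N(1,2), of q] N(3) pq by (force split: if_splits simp: le_Suc_eq)
  have Nq: "mdeg N q = Suc (a q)"
    using no1[OF N(1,2), of p] N(3) pq by (force split: if_splits simp: le_Suc_eq)
  have "mdeg M p < mdeg N p" using M(3)[of p] Np by simp
  from E M(1) N(1) this show ?thesis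
  proof (cases rule: matching_exchange)
    case (both M' N' r)
    consider "r = p" | "r = q" | "r \<noteq> p" "r \<noteq> q" by blast
    then show ?thesis
    proof cases
      \<comment> \<open>The walk is closed: \<open>N'\<close> loses two units at \<open>p\<close>,
        going from \<open>a p + 1\<close> to \<open>a p - 1\<close>, and is the wanted
        matching.\<close>
      case 1
      have "mdeg N' x \<le> (a(p := a p - 1, q := Suc (a q))) x" for x
        using both(6)[of x] N(3)[of x] 1 pq Np by (auto split: if_splits)
      then show ?thesis using both N by (intro has_matchingI[of N']) auto
    next
      \<comment> \<open>Here \<open>N'\<close>, and in the next case \<open>M'\<close>, would have
        \<open>k + 1\<close> edges and fit \<open>a\<close>.\<close>
      case 2
      have "mdeg N' x \<le> a x" for x
        using both(6)[of x] N(3)[of x] 2 pq Np Nq by (auto split: if_splits)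
      then show ?thesis using both N no[of N'] by auto
    next
      case 3
      have "mdeg M' x \<le> a x" for x
        using both(5)[of x] both(7) M(3)[of x] N(3)[of x] 3 pq a by (auto split: if_splits)
      then show ?thesis using both M no[of M'] by auto
    qed
  next
    case (swap M' N' r)
    \<comment> \<open>Now \<open>N'\<close> keeps \<open>k + 2\<close> edges, and \<open>q\<close>
      is the only vertex where it exceeds \<open>a\<close>.\<close>
    have r: "r \<noteq> p" "r \<noteq> q" using swap(7) M(3)[of p] M(3)[of q] Np Nq pq by auto
    have "mdeg N' x \<le> (a(q := Suc (a q))) x" for x
      using swap(6)[of x] swap(7) N(3)[of x] M(3)[of x] r pq Np by (auto split: if_splits)
    then show ?thesis using swap N no1[of N' q] by auto
  qed
qed

lemma not_has_matching_add_edge: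
  assumes E: "\<forall>e\<in>E. card e = 2" and pq: "{p, q} \<in> E" "p \<noteq> q" and a: "0 < a p" "0 < a q"
    and p: "has_matching E (a(p := a p - 1)) k" and q: "has_matching E (a(q := a q - 1)) k"
    and no: "\<not> has_matching E a (Suc k)"
  shows "\<not> has_matching E (a(p := Suc (a p), q := Suc (a q))) (Suc (Suc k))"
proof
  assume *: "has_matching E (a(p := Suc (a p), q := Suc (a q))) (Suc (Suc k))"
  have "has_matching E (a(p := a p - 1, q := Suc (a q))) (Suc k)"
    by (rule shifted_matching) (use assms * in auto)
  then obtain U where U: "set_mset U \<subseteq> E" "size U = Suc k"
    "\<And>i. mdeg U i \<le> (a(p := a p - 1, q := Suc (a q))) i"
    by (auto simp: has_matching_def)
  have "has_matching E (a(q := a q - 1, p := Suc (a p))) (Suc k)"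
    by (rule shifted_matching) (use assms * in \<open>auto simp: fun_upd_twist\<close>)
  then obtain W where W: "set_mset W \<subseteq> E" "size W = Suc k"
    "\<And>i. mdeg W i \<le> (a(q := a q - 1, p := Suc (a p))) i"
    by (auto simp: has_matching_def)
  have no0: False if "set_mset L \<subseteq> E" "size L = Suc k" "\<And>i. mdeg L i \<le> a i" for L
    using that no by (auto simp: has_matching_def)
  have no1: False if "set_mset L \<subseteq> E" "size L = Suc (Suc k)" "\<And>i. mdeg L i \<le> (a(x := Suc (a x))) i" for L x
    using that not_has_matching_inc[OF E no, of x] by (auto simp: has_matching_def)
  \<comment> \<open>No \<open>k\<close> edges fit when both ends are lowered, because the edge
    \<open>{p, q}\<close> could be put back to give \<open>k + 1\<close> edges in
    \<open>a\<close>.\<close>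
  have no2: False if L: "set_mset L \<subseteq> E" "size L = k" "\<And>i. mdeg L i \<le> (a(p := a p - 1, q := a q - 1)) i" for L
  proof -
    have "has_matching E (a(p := a p - 1, q := a q - 1)) k"
      unfolding has_matching_def using L by blast
    from has_matching_add_edge[OF this pq] have "has_matching E a (Suc k)"
      by (rule has_matching_mono) (use a pq in auto)
    then show False using no by blast
  qed
  have Uq: "mdeg U q = Suc (a q)"
  proof (rule ccontr)
    assume "mdeg U q \<noteq> Suc (a q)"
    then have "mdeg U i \<le> a i" for i using U(3)[of i] pq by (auto split: if_splits)
    then show False using no0 U by blast
  qed
  have Wp: "mdeg W p = Suc (a p)"
  proof (rule ccontr)
    assume "mdeg W p \<noteq> Suc (a p)"
    then have "mdeg W i \<le> a i" for i using W(3)[of i] pq by (auto split: if_splits)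
    then show False using no0 W by blast
  qed
  \<comment> \<open>Every outcome of the exchange at \<open>p\<close> gives a matching too large for
    its capacities, with offsets \<open>(-1, -1)\<close>, \<open>(0, 1)\<close> or
    \<open>(0, 0)\<close> at \<open>p\<close> and \<open>q\<close>.\<close>
  have "mdeg U p < mdeg W p" using U(3)[of p] Wp pq by simp
  from E U(1) W(1) this show False
  proof (cases rule: matching_exchange)
    case (both U' W' r)
    have rq: "r \<noteq> q" using both(7) Uq W(3)[of q] pq by auto
    show False
    proof (cases "r = p")
      case True
      have "mdeg W' x \<le> (a(p := a p - 1, q := a q - 1)) x" for x
        using both(6)[of x] W(3)[of x] True pq by (auto split: if_splits)
      then show ?thesis using both W no2[of W'] by auto
    next
      case False
      have "mdeg U' x \<le> (a(q := Suc (a q))) x" for x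
        using both(5)[of x] both(7) U(3)[of x] W(3)[of x] False rq pq a by (auto split: if_splits)
      then show ?thesis using both U no1[of U' q] by auto
    qed
  next
    case (swap U' W' r)
    have rp: "r \<noteq> p" using swap(7) U(3)[of p] Wp pq by auto
    show False
    proof (cases "r = q")
      case True
      have "mdeg U' x \<le> a x" for x
        using swap(5)[of x] U(3)[of x] True pq a by (auto split: if_splits)
      then show ?thesis using swap U no0[of U'] by auto
    next
      case False
      have "mdeg W' x \<le> a x" for x
        using swap(6)[of x] swap(7) U(3)[of x] W(3)[of x] False rp pq a by (auto split: if_splits)
      then show ?thesis using swap W no0[of W'] by auto
    qed
  qed
qed

section \<open>Degree counts and raising the number of edges\<close>

lemma mdeg_sum: "mdeg (sum f A) i = (\<Sum>x\<in>A. mdeg (f x) i)"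
  by (induction A rule: infinite_finite_induct) auto

lemma mdeg_le_size: "mdeg M i \<le> size M"
  by (simp add: mdeg_def size_filter_mset_lesseq)

lemma size_sum_mset_sum: "size (sum f A :: 'a multiset) = (\<Sum>x\<in>A. size (f x))"
  by (induction A rule: infinite_finite_induct) auto

text \<open>Each edge meeting \<open>U\<close> is counted by some degree on \<open>U\<close>, so
  these degrees bound the loss when such edges are discarded.\<close>

lemma size_avoiding:
  assumes "finite U"
  shows "size M \<le> size {#e \<in># M. e \<inter> U = {}#} + (\<Sum>i\<in>U. mdeg M i)"
proof -
  let ?H = "{#e \<in># M. \<not> e \<inter> U = {}#}"
  have "size M = size {#e \<in># M. e \<inter> U = {}#} + size ?H"
    by (metis multiset_partition size_union)
  moreover have "size ?H \<le> (\<Sum>i\<in>U. mdeg ?H i)"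
    using size_le_sum_incidences[OF assms, of ?H] by (simp add: mdeg_def)
  moreover have "\<dots> \<le> (\<Sum>i\<in>U. mdeg M i)"
    by (intro sum_mono mdeg_mono) simp
  ultimately show ?thesis by simp
qed

lemma matching_persistence:
  assumes E: "\<forall>e\<in>E. card e = 2" and K: "K \<noteq> {}" and a: "\<And>i. i \<notin> K \<Longrightarrow> a i = 0"
    and no: "\<not> has_matching E a s" and inc: "\<And>i. i \<in> K \<Longrightarrow> has_matching E (a(i := Suc (a i))) s"
  shows "\<exists>a'. (\<forall>i. i \<notin> K \<longrightarrow> a' i = 0) \<and> \<not> has_matching E a' (Suc s)
    \<and> (\<forall>i\<in>K. has_matching E (a'(i := Suc (a' i))) (Suc s))"
proof -
  have "has_matching E a 0" by (intro has_matchingI[of "{#}"]) auto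
  then obtain k where s: "s = Suc k" using no by (cases s) auto
  obtain i where i: "i \<in> K" using K by blast
  \<comment> \<open>The first application only finds a vertex \<open>p\<close> missed by a maximum
    matching. Applied again at \<open>p\<close>, it yields a neighbor \<open>q\<close> that is also
    missed by one.\<close>
  obtain p where p: "0 < a p" "has_matching E (a(p := a p - 1)) k"
    using has_matching_inc[OF E, of a i k] inc[OF i] no s by blast
  have pK: "p \<in> K" using p a by (metis less_irrefl)
  obtain q where q: "{p, q} \<in> E" "q \<noteq> p" "0 < a q" "has_matching E (a(q := a q - 1)) k"
    using has_matching_inc[OF E, of a p k] inc[OF pK] no s by blast
  have qK: "q \<in> K" using q a by (metis less_irrefl)
  let ?a = "a(p := Suc (a p), q := Suc (a q))"
  have "\<not> has_matching E ?a (Suc s)"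
    using not_has_matching_add_edge[OF E q(1) _ p(1) q(3) p(2) q(4)] no q(2) s by auto
  \<comment> \<open>The edge \<open>{p, q}\<close> joins the matching that exists for
    \<open>a\<close> increased at \<open>i\<close>.\<close>
  moreover have "has_matching E (?a(i := Suc (?a i))) (Suc s)" if "i \<in> K" for i
    by (rule has_matching_mono[OF has_matching_add_edge[OF inc[OF that] q(1)]]) (use q(2) in auto)
  moreover have "\<forall>i. i \<notin> K \<longrightarrow> ?a i = 0" using a pK qK by auto
  ultimately show ?thesis by blast
qed

lemma matching_persistence_add:
  assumes "\<forall>e\<in>E. card e = 2" "K \<noteq> {}" "\<And>i. i \<notin> K \<Longrightarrow> a i = 0"
    "\<not> has_matching E a s" "\<And>i. i \<in> K \<Longrightarrow> has_matching E (a(i := Suc (a i))) s"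
  shows "\<exists>a'. (\<forall>i. i \<notin> K \<longrightarrow> a' i = 0) \<and> \<not> has_matching E a' (s + d)
    \<and> (\<forall>i\<in>K. has_matching E (a'(i := Suc (a' i))) (s + d))"
proof (induction d)
  case 0
  show ?case using assms by (intro exI[of _ a]) (simp del: fun_upd_apply)
next
  case (Suc d)
  then obtain a' where "\<And>i. i \<notin> K \<Longrightarrow> a' i = 0" "\<not> has_matching E a' (s + d)"
    "\<And>i. i \<in> K \<Longrightarrow> has_matching E (a'(i := Suc (a' i))) (s + d)" by blast
  from matching_persistence[OF assms(1,2) this] show ?case by (simp del: fun_upd_apply)
qed

section \<open>Exponents of annihilator monomials\<close>

text \<open>
  If \<open>Q\<close> describes the exponents of a monomial ideal \<open>J\<close>, this says that \<open>J : x\<^sup>b = P\<^sub>F\<close>; see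
  \<open>associated_prime_monomial_span_iff\<close> below.
\<close>

definition socle_exponent :: "(('v \<Rightarrow> nat) \<Rightarrow> bool) \<Rightarrow> 'v set \<Rightarrow> ('v \<Rightarrow> nat) \<Rightarrow> bool"
  where "socle_exponent Q F b \<longleftrightarrow>
    (\<forall>i\<in>F. Q (b(i := Suc (b i)))) \<and> (\<forall>c. (\<forall>i\<in>F. c i = 0) \<longrightarrow> \<not> Q (\<lambda>i. b i + c i))"

lemma socle_exponent_exists:
  fixes b :: "'v::finite \<Rightarrow> nat"
  assumes mono: "\<And>b c. Q b \<Longrightarrow> (\<And>i. b i \<le> c i) \<Longrightarrow> Q c"
    and pow: "\<And>i. i \<in> F \<Longrightarrow> \<exists>m. Q (b(i := b i + m))"
    and no: "\<And>c. (\<forall>i\<in>F. c i = 0) \<Longrightarrow> \<not> Q (\<lambda>i. b i + c i)"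
  shows "\<exists>b'. socle_exponent Q F b'"
proof -
  obtain m where m: "\<forall>i\<in>F. Q (b(i := b i + m i))"
    using bchoice[of F "\<lambda>i m. Q (b(i := b i + m))"] pow by blast
  \<comment> \<open>These are the surviving multiples of \<open>x^b\<close> by monomials in the
    variables of \<open>F\<close>. The bounds \<open>m\<close> limit their degree, so one of largest
    degree exists.\<close>
  define S where "S d \<longleftrightarrow> (\<forall>i. i \<notin> F \<longrightarrow> d i = 0) \<and>
    (\<forall>c. (\<forall>i\<in>F. c i = 0) \<longrightarrow> \<not> Q (\<lambda>i. b i + d i + c i))" for d
  have "d i \<le> m i" if "S d" "i \<in> F" for d i
  proof (rule ccontr)
    assume "\<not> d i \<le> m i"
    then have "Q (\<lambda>i. b i + d i + 0)" by (intro mono[OF m[rule_format, OF that(2)]]) auto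
    moreover have "\<not> Q (\<lambda>i. b i + d i + 0)"
      using that(1) unfolding S_def by (elim conjE allE[of _ "\<lambda>_. 0"]) simp
    ultimately show False by simp
  qed
  then have "d i \<le> (if i \<in> F then m i else 0)" if "S d" for d i
    using that by (auto simp: S_def)
  then have bd: "\<forall>d. S d \<longrightarrow> (\<Sum>i\<in>UNIV. d i) \<le> (\<Sum>i\<in>UNIV. if i \<in> F then m i else 0)"
    by (auto intro!: sum_mono)
  have "S (\<lambda>_. 0)" using no by (auto simp: S_def)
  then obtain d where d: "S d" and max: "\<And>d'. S d' \<Longrightarrow> (\<Sum>i\<in>UNIV. d' i) \<le> (\<Sum>i\<in>UNIV. d i)"
    using ex_has_greatest_nat[of S _ "\<lambda>d. \<Sum>i\<in>UNIV. d i" "Suc (\<Sum>i\<in>UNIV. if i \<in> F then m i else 0)"] bd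
    by (metis le_imp_less_Suc)
  have "\<exists>c. (\<forall>j\<in>F. c j = 0) \<and> Q (\<lambda>j. b j + (d(i := Suc (d i))) j + c j)" if i: "i \<in> F" for i
  proof -
    have "(\<Sum>j\<in>UNIV. d j) < (\<Sum>j\<in>UNIV. (d(i := Suc (d i))) j)"
      by (rule sum_strict_mono_ex1) auto
    then have "\<not> S (d(i := Suc (d i)))" using max by (meson leD)
    moreover have "\<forall>j. j \<notin> F \<longrightarrow> (d(i := Suc (d i))) j = 0" using d i by (auto simp: S_def)
    ultimately show ?thesis unfolding S_def by blast
  qed
  then obtain c where "\<forall>i\<in>F. (\<forall>j\<in>F. c i j = 0) \<and> Q (\<lambda>j. b j + (d(i := Suc (d i))) j + c i j)"
    using bchoice[of F "\<lambda>i c. (\<forall>j\<in>F. c j = 0) \<and> Q (\<lambda>j. b j + (d(i := Suc (d i))) j + c j)"] by blast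
  then have c0: "\<And>i j. i \<in> F \<Longrightarrow> j \<in> F \<Longrightarrow> c i j = 0"
    and c: "\<And>i. i \<in> F \<Longrightarrow> Q (\<lambda>j. b j + (d(i := Suc (d i))) j + c i j)" by blast+
  \<comment> \<open>By maximality of \<open>d\<close>, one more factor at \<open>i\<close> is killed
    by a monomial \<open>c i\<close> off \<open>F\<close>. The product of all these serves every
    \<open>i\<close> at once, and multiplying by it cannot kill, since it involves no variable of
    \<open>F\<close>.\<close>
  define b' where "b' j = b j + d j + (\<Sum>i\<in>F. c i j)" for j
  have "socle_exponent Q F b'"
    unfolding socle_exponent_def
  proof (intro conjI ballI allI impI)
    fix i assume i: "i \<in> F"
    have "c i j \<le> (\<Sum>i\<in>F. c i j)" for j using i by (intro member_le_sum) auto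
    then show "Q (b'(i := Suc (b' i)))"
      by (intro mono[OF c[OF i]]) (auto simp: b'_def intro!: add_mono)
  next
    fix e :: "'v \<Rightarrow> nat" assume "\<forall>i\<in>F. e i = 0"
    then have "\<forall>j\<in>F. (\<Sum>i\<in>F. c i j) + e j = 0" using c0 by auto
    then have "\<not> Q (\<lambda>j. b j + d j + ((\<Sum>i\<in>F. c i j) + e j))"
      using d unfolding S_def by (elim conjE allE[of _ "\<lambda>j. (\<Sum>i\<in>F. c i j) + e j"]) simp
    then show "\<not> Q (\<lambda>i. b' i + e i)" by (simp add: b'_def add.assoc)
  qed
  then show ?thesis by blast
qed

section \<open>Exponents supported on the core\<close>

lemma edge_other_end:
  assumes "\<forall>e\<in>E. card e = 2" "e \<in> E" "x \<in> e"
  obtains y where "e = {x, y}" "y \<noteq> x"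
proof -
  have "card e = 2" using assms by blast
  then obtain u v where "e = {u, v}" "u \<noteq> v" by (auto simp: card_2_iff)
  then show thesis using assms(3) that by (metis insertE insert_commute singletonD)
qed

lemma core_nbr:
  assumes "i \<in> F - core E F"
  shows "\<exists>j. j \<notin> F \<and> {i, j} \<in> E"
  using assms unfolding core_def by blast

text \<open>The end in \<open>F\<close> has the neighbor \<open>x\<close> outside \<open>F\<close>,
  so no edge leaving \<open>F\<close> touches the core.\<close>

lemma cover_edge:
  assumes "\<forall>e\<in>E. card e = 2" "cover E F" "e \<in> E" "x \<in> e" "x \<notin> F"
  obtains y where "e = {x, y}" "y \<in> F" "y \<notin> core E F"
proof -
  obtain y where e: "e = {x, y}" using edge_other_end assms(1,3,4) by metis
  then have y: "e = {x, y}" "y \<in> F" using assms(2,3,5) by (auto simp: cover_def)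
  then have "y \<notin> core E F" using assms by (auto simp: core_def insert_commute)
  with y show thesis using that by blast
qed

lemma core_matching_of_socle:
  fixes E :: "'v::finite set set"
  assumes E: "\<forall>e\<in>E. card e = 2" and F: "cover E F" and core: "core E F \<noteq> {}"
    and b: "socle_exponent (\<lambda>b. has_matching E b t) F b"
  shows "\<exists>a. (\<forall>i. i \<notin> core E F \<longrightarrow> a i = 0) \<and> \<not> has_matching E a t
    \<and> (\<forall>i\<in>core E F. has_matching E (a(i := Suc (a i))) t)"
proof -
  define K where "K = core E F"
  have KF: "K \<subseteq> F" by (auto simp: K_def core_def)
  define a where "a i = (if i \<in> K then b i else 0)" for i
  define d where "d = (\<Sum>i\<in>F - K. b i)"
  obtain g where g: "\<And>i. i \<in> F - K \<Longrightarrow> g i \<notin> F \<and> {i, g i} \<in> E"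
  proof -
    have "\<forall>i\<in>F - K. \<exists>j. j \<notin> F \<and> {i, j} \<in> E" using core_nbr unfolding K_def by (rule ballI)
    then show thesis using that by metis
  qed
  \<comment> \<open>Each vertex of \<open>F - K\<close> spends its whole capacity on an edge to a
    neighbor outside \<open>F\<close>. This gives \<open>d\<close> edges that avoid
    \<open>K\<close>.\<close>
  define L where "L = (\<Sum>i\<in>F - K. replicate_mset (b i) {i, g i})"
  have sizeL: "size L = d" by (simp add: L_def d_def size_sum_mset_sum)
  have LE: "set_mset L \<subseteq> E" using g by (auto simp: L_def set_mset_sum split: if_splits)
  have degL: "mdeg L x \<le> (if x \<in> F - K then b x else 0)" if "x \<in> F" for x
  proof -
    have "mdeg L x = (\<Sum>i\<in>F - K. if x = i then b i else 0)"
      unfolding L_def mdeg_sum using g that by (intro sum.cong) auto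
    then show ?thesis by simp
  qed
  \<comment> \<open>A matching of \<open>a\<close> extends by \<open>L\<close>. Off \<open>F\<close>
    the exponent \<open>b\<close> may be enlarged freely, and \<open>d\<close> more units suffice
    for the \<open>d\<close> edges of \<open>L\<close>.\<close>
  have less: "s + d < t" if s: "has_matching E a s" for s
  proof (rule ccontr)
    assume "\<not> s + d < t"
    obtain M where M: "set_mset M \<subseteq> E" "size M = s" "\<And>i. mdeg M i \<le> a i"
      using has_matchingE[OF s] by metis
    have "has_matching E (\<lambda>i. b i + (if i \<in> F then 0 else d)) (s + d)"
    proof (rule has_matchingI)
      show "mdeg (M + L) x \<le> b x + (if x \<in> F then 0 else d)" for x
      proof (cases "x \<in> F")
        case True
        then show ?thesis using M(3)[of x] degL[of x] by (auto simp: a_def split: if_splits)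
      next
        case False
        then have "x \<notin> K" using KF by auto
        then show ?thesis using False M(3)[of x] mdeg_le_size[of L x] sizeL by (auto simp: a_def)
      qed
    qed (use M LE sizeL in auto)
    then have "has_matching E (\<lambda>i. b i + (if i \<in> F then 0 else d)) t"
      by (rule has_matching_mono) (use \<open>\<not> s + d < t\<close> in auto)
    then show False using b by (simp add: socle_exponent_def)
  qed
  have "has_matching E a 0" by (intro has_matchingI[of "{#}"]) auto
  \<comment> \<open>The case \<open>s = 0\<close> shows that \<open>t - d\<close> is a true
    difference.\<close>
  then have dt: "d < t" using less by fastforce
  have no: "\<not> has_matching E a (t - d)" using less[of "t - d"] dt by auto
  have inc: "has_matching E (a(i := Suc (a i))) (t - d)" if i: "i \<in> K" for i
  proof -
    have "has_matching E (b(i := Suc (b i))) t" using b i KF by (auto simp: socle_exponent_def)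
    then obtain M where M: "set_mset M \<subseteq> E" "size M = t" "\<And>x. mdeg M x \<le> (b(i := Suc (b i))) x"
      by (metis has_matchingE)
    \<comment> \<open>At most \<open>d\<close> edges are discarded. An edge leaving \<open>F\<close>
      has its other end in \<open>F - K\<close>, so the remaining edges lie inside
      \<open>K\<close>.\<close>
    define M0 where "M0 = {#e \<in># M. e \<inter> (F - K) = {}#}"
    have "mdeg M x \<le> b x" if "x \<in> F - K" for x using M(3)[of x] that i by (auto split: if_splits)
    then have "(\<Sum>x\<in>F - K. mdeg M x) \<le> d" unfolding d_def by (intro sum_mono) auto
    then have size0: "t - d \<le> size M0" using size_avoiding[of "F - K" M] M(2) by (simp add: M0_def)
    have "has_matching E (a(i := Suc (a i))) (size M0)"
    proof (rule has_matchingI)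
      show "mdeg M0 x \<le> (a(i := Suc (a i))) x" for x
      proof (cases "x \<in> K")
        case True
        have "mdeg M0 x \<le> mdeg M x" by (intro mdeg_mono) (simp add: M0_def)
        then show ?thesis using True M(3)[of x] i by (auto simp: a_def split: if_splits)
      next
        case False
        have "x \<notin> e" if e: "e \<in># M0" for e
        proof
          assume x: "x \<in> e"
          then have "x \<notin> F" using e False by (auto simp: M0_def)
          moreover have "e \<in> E" using e M(1) by (auto simp: M0_def)
          ultimately obtain y where "e = {x, y}" "y \<in> F" "y \<notin> K"
            using cover_edge[OF E F] x unfolding K_def by metis
          then show False using e by (auto simp: M0_def)
        qed
        then have "mdeg M0 x = 0" using mdeg_pos_iff[of M0 x] by blast
        then show ?thesis by simp
      qed
    qed (use M in \<open>auto simp: M0_def\<close>)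
    then show ?thesis by (rule has_matching_mono) (use size0 in auto)
  qed
  \<comment> \<open>Persistence makes up for the \<open>d\<close> edges lost.\<close>
  have "\<exists>a'. (\<forall>i. i \<notin> K \<longrightarrow> a' i = 0) \<and> \<not> has_matching E a' (t - d + d)
    \<and> (\<forall>i\<in>K. has_matching E (a'(i := Suc (a' i))) (t - d + d))"
    by (rule matching_persistence_add) (use E core no inc in \<open>auto simp: K_def[symmetric] a_def\<close>)
  then show ?thesis using dt by (simp add: K_def)
qed

lemma socle_of_core_matching:
  fixes E :: "'v::finite set set"
  assumes E: "\<forall>e\<in>E. card e = 2" and F: "cover E F"
    and a: "\<And>i. i \<notin> core E F \<Longrightarrow> a i = 0" and no: "\<not> has_matching E a t"
    and pow: "\<And>i. i \<in> core E F \<Longrightarrow> \<exists>m. has_matching E (a(i := a i + m)) t"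
  shows "\<exists>b. socle_exponent (\<lambda>b. has_matching E b t) F b"
proof (rule socle_exponent_exists)
  let ?b = "\<lambda>i. if i \<in> F then a i else t"
  have out: "a i = 0" if "i \<notin> F" for i using a that by (auto simp: core_def)
  show "\<exists>m. has_matching E (?b(i := ?b i + m)) t" if i: "i \<in> F" for i
  proof (cases "i \<in> core E F")
    case True
    then obtain m where "has_matching E (a(i := a i + m)) t" using pow by blast
    then have "has_matching E (?b(i := ?b i + m)) t"
      by (rule has_matching_mono) (use out i in auto)
    then show ?thesis ..
  next
    case False
    then obtain j where j: "j \<notin> F" "{i, j} \<in> E" using core_nbr[of i F E] i by blast
    \<comment> \<open>Capacity \<open>t\<close> off \<open>F\<close> lets the non-core vertex
      \<open>i\<close> be matched \<open>t\<close> times to one outside neighbor.\<close>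
    have "has_matching E (?b(i := ?b i + t)) t"
      by (rule has_matchingI[of "replicate_mset t {i, j}"]) (use i j in \<open>auto split: if_splits\<close>)
    then show ?thesis ..
  qed
  show "\<not> has_matching E (\<lambda>i. ?b i + c i) t" if c: "\<forall>i\<in>F. c i = 0" for c
  proof
    assume "has_matching E (\<lambda>i. ?b i + c i) t"
    then obtain M where M: "set_mset M \<subseteq> E" "size M = t" "\<And>x. mdeg M x \<le> ?b x + c x"
      by (metis (no_types, lifting) has_matchingE)
    \<comment> \<open>An edge leaving \<open>F\<close> would need capacity at a non-core vertex of
      \<open>F\<close>, where \<open>a\<close> vanishes. Hence factors off \<open>F\<close> cannot
      help.\<close>
    have "mdeg M x \<le> a x" for x
    proof (cases "x \<in> F")
      case True
      then show ?thesis using M(3)[of x] c by simp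
    next
      case False
      have "x \<notin> e" if e: "e \<in># M" for e
      proof
        assume x: "x \<in> e"
        have "e \<in> E" using M(1) e by auto
        then obtain y where y: "e = {x, y}" "y \<in> F" "y \<notin> core E F"
          using cover_edge[OF E F] False x by metis
        then have "0 < mdeg M y" using e by (auto simp: mdeg_pos_iff)
        then have "0 < a y" using M(3)[of y] y c by simp
        then show False using a y by simp
      qed
      then have "mdeg M x = 0" using mdeg_pos_iff[of M x] by blast
      then show ?thesis by simp
    qed
    then show False using no M by (auto simp: has_matching_def)
  qed
qed (rule has_matching_mono, auto)

section \<open>Covers with empty core\<close>

lemma cover_remove_core:
  assumes "\<forall>e\<in>E. card e = 2" "cover E C" "i \<in> core E C"
  shows "cover E (C - {i})"
  unfolding cover_def
proof
  fix e assume e: "e \<in> E"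
  show "e \<inter> (C - {i}) \<noteq> {}"
  proof (cases "i \<in> e")
    case True
    then obtain j where "e = {i, j}" "j \<noteq> i" using edge_other_end assms(1) e by metis
    then show ?thesis using assms(3) e by (auto simp: core_def)
  qed (use assms(2) e in \<open>auto simp: cover_def\<close>)
qed

lemma coreless_cover_exists:
  fixes E :: "'v::finite set set"
  assumes E: "\<forall>e\<in>E. card e = 2" and F: "cover E F" and core: "core E F \<noteq> {}"
  obtains C where "C \<subset> F" "cover E C" "core E C = {}"
proof -
  obtain i where i: "i \<in> core E F" using core by blast
  let ?P = "\<lambda>C. C \<subseteq> F - {i} \<and> cover E C"
  have "?P (F - {i})" using cover_remove_core[OF E F i] by simp
  then obtain C where C: "?P C" and min: "\<And>D. ?P D \<Longrightarrow> card C \<le> card D"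
    using ex_has_least_nat[of ?P "F - {i}" card] by (elim exE conjE) blast
  have "core E C = {}"
  proof (rule ccontr)
    assume "core E C \<noteq> {}"
    then obtain j where j: "j \<in> core E C" by blast
    then have "?P (C - {j})" using C cover_remove_core[OF E] by blast
    moreover have "j \<in> C" using j by (auto simp: core_def)
    ultimately show False using min by (metis card_Diff1_less finite leD)
  qed
  moreover have "C \<subset> F" using C i by (auto simp: core_def)
  ultimately show thesis using that C by blast
qed

section \<open>Weighted graphs and multiset matchings\<close>

text \<open>Vertices of \<open>N\<close> and vertices of weight zero alike carry no edge, and
  matchings can be shortened, so a lower bound on the maximum is the existence of a matching of that
  size.\<close>

lemma matching_number_remove_ge_iff:
  fixes E :: "'v::finite set set"
  assumes "simple_graph UNIV E"
  shows "s \<le> matching_number (remove_verts (graph_of E a) N) \<longleftrightarrow>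
    has_matching E (\<lambda>i. if i \<in> N then 0 else a i) s"
proof -
  let ?G = "remove_verts (graph_of E a) N" and ?a = "\<lambda>i. if i \<in> N then 0 else a i"
  have w: "weighted_graph ?G"
    by (intro weighted_graph_remove_verts weighted_graph_graph_of assms)
  have "matching ?G M \<longleftrightarrow> set_mset M \<subseteq> E \<and> (\<forall>i. mdeg M i \<le> ?a i)" for M
  proof -
    have *: "matching ?G M \<longleftrightarrow> set_mset M \<subseteq> E \<and>
        (\<forall>e\<in>#M. e \<subseteq> pos_verts a \<and> e \<inter> N = {}) \<and> (\<forall>i\<in>pos_verts a - N. mdeg M i \<le> a i)"
      unfolding matching_def mdeg_def remove_verts_def graph_of_def by auto
    show ?thesis
    proof
      assume M: "matching ?G M"
      have "mdeg M i \<le> ?a i" for i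
      proof (cases "i \<in> pos_verts a - N")
        case False
        then have "\<forall>e\<in>#M. i \<notin> e" using M * by blast
        then have "mdeg M i = 0" using mdeg_pos_iff[of M i] by blast
        then show ?thesis by simp
      qed (use M * in auto)
      then show "set_mset M \<subseteq> E \<and> (\<forall>i. mdeg M i \<le> ?a i)" using M * by blast
    next
      assume M: "set_mset M \<subseteq> E \<and> (\<forall>i. mdeg M i \<le> ?a i)"
      have "i \<in> pos_verts a \<and> i \<notin> N" if "e \<in># M" "i \<in> e" for e i
      proof -
        have "0 < mdeg M i" using that by (auto simp: mdeg_pos_iff)
        then have "0 < ?a i" using M less_le_trans by blast
        then show ?thesis by (simp add: pos_verts_def split: if_splits)
      qed
      moreover have "mdeg M i \<le> a i" if "i \<in> pos_verts a - N" for i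
        using M[THEN conjunct2, rule_format, of i] that by simp
      ultimately show "matching ?G M" unfolding * using M by blast
    qed
  qed
  then have "{size M | M. matching ?G M} = {s. has_matching E ?a s}"
    by (auto simp: has_matching_def)
  then have "s \<le> matching_number ?G \<longleftrightarrow> (\<exists>r. has_matching E ?a r \<and> s \<le> r)"
    using Max_ge_iff[OF matching_sizes[OF w], of s] by (auto simp: matching_number_def)
  also have "\<dots> \<longleftrightarrow> has_matching E ?a s" by (blast intro: has_matching_mono[OF _ order_refl])
  finally show ?thesis .
qed

lemma matching_number_ge_iff:
  fixes E :: "'v::finite set set"
  assumes "simple_graph UNIV E"
  shows "s \<le> matching_number (graph_of E a) \<longleftrightarrow> has_matching E a s"
proof -
  have "remove_verts (graph_of E a) {} = graph_of E a"
    by (simp add: remove_verts_def graph_of_def)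
  then show ?thesis using matching_number_remove_ge_iff[OF assms, of s a "{}"] by simp
qed

text \<open>At most \<open>degree_of E a i\<close> edges meet \<open>nbhd_of E a i\<close>. Every
  edge at \<open>i\<close> is among them, so the capacity \<open>m\<close> at \<open>i\<close> does
  not matter for the rest.\<close>

lemma has_matching_remove_nbhd:
  fixes E :: "'v::finite set set"
  assumes E: "\<forall>e\<in>E. card e = 2" and m: "has_matching E (a(i := m)) t"
  shows "has_matching E (\<lambda>j. if j \<in> nbhd_of E a i then 0 else a j) (t - degree_of E a i)"
proof -
  let ?N = "nbhd_of E a i"
  have iN: "i \<notin> ?N" using E by (auto simp: nbhd_of_def)
  obtain M where M: "set_mset M \<subseteq> E" "size M = t" "\<And>x. mdeg M x \<le> (a(i := m)) x"
    using has_matchingE[OF m] by metis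
  define M0 where "M0 = {#e \<in># M. e \<inter> ?N = {}#}"
  have "mdeg M x \<le> a x" if "x \<in> ?N" for x using M(3)[of x] that iN by (auto split: if_splits)
  then have "(\<Sum>x\<in>?N. mdeg M x) \<le> degree_of E a i"
    unfolding degree_of_def by (intro sum_mono) auto
  then have size0: "t - degree_of E a i \<le> size M0"
    using size_avoiding[of ?N M] M(2) by (simp add: M0_def)
  have "has_matching E (\<lambda>j. if j \<in> ?N then 0 else a j) (size M0)"
  proof (rule has_matchingI)
    fix x
    have i0: "i \<notin> e" if e: "e \<in># M0" for e
    proof
      assume "i \<in> e"
      moreover have "e \<in> E" "e \<in># M" using e M(1) by (auto simp: M0_def)
      ultimately obtain j where j: "e = {i, j}" "j \<noteq> i" using edge_other_end E by metis
      then have "0 < mdeg M j" using \<open>e \<in># M\<close> by (auto simp: mdeg_pos_iff)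
      then have "j \<in> ?N" using M(3)[of j] j \<open>e \<in> E\<close> by (auto simp: nbhd_of_def pos_verts_def)
      then show False using e j by (auto simp: M0_def)
    qed
    show "mdeg M0 x \<le> (if x \<in> ?N then 0 else a x)"
    proof (cases "x \<in> ?N \<or> x = i")
      case True
      then have "mdeg M0 x = 0" using mdeg_pos_iff[of M0 x] i0 by (auto simp: M0_def)
      then show ?thesis by simp
    next
      case False
      have "mdeg M0 x \<le> mdeg M x" by (intro mdeg_mono) (simp add: M0_def)
      then show ?thesis using False M(3)[of x] by auto
    qed
  qed (use M in \<open>auto simp: M0_def\<close>)
  then show ?thesis by (rule has_matching_mono) (use size0 in auto)
qed

text \<open>A star at \<open>i\<close> with \<open>a j\<close> copies of each \<open>{i, j}\<close>
  uses the freed weights of the neighbors; the extra capacity at \<open>i\<close> is exactly what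
  the star takes.\<close>

lemma has_matching_of_remove_nbhd:
  fixes E :: "'v::finite set set"
  assumes E: "\<forall>e\<in>E. card e = 2"
    and m: "has_matching E (\<lambda>j. if j \<in> nbhd_of E a i then 0 else a j) (t - degree_of E a i)"
  shows "has_matching E (a(i := a i + degree_of E a i)) t"
proof -
  let ?N = "nbhd_of E a i" and ?d = "degree_of E a i"
  have iN: "i \<notin> ?N" using E by (auto simp: nbhd_of_def)
  obtain M where M: "set_mset M \<subseteq> E" "size M = t - ?d" "\<And>x. mdeg M x \<le> (if x \<in> ?N then 0 else a x)"
    using has_matchingE[OF m] by metis
  define L where "L = (\<Sum>j\<in>?N. replicate_mset (a j) {i, j})"
  have sizeL: "size L = ?d" by (simp add: L_def degree_of_def size_sum_mset_sum)
  have LE: "set_mset L \<subseteq> E" by (auto simp: L_def set_mset_sum nbhd_of_def split: if_splits)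
  have "has_matching E (a(i := a i + ?d)) (t - ?d + ?d)"
  proof (rule has_matchingI)
    fix x
    show "mdeg (M + L) x \<le> (a(i := a i + ?d)) x"
    proof (cases "x = i")
      case True
      then show ?thesis using M(3)[of i] iN mdeg_le_size[of L i] sizeL by simp
    next
      case False
      have "mdeg L x = (\<Sum>j\<in>?N. if x = j then a j else 0)"
        unfolding L_def mdeg_sum using False by (intro sum.cong) auto
      then show ?thesis using M(3)[of x] False by (auto split: if_splits)
    qed
  qed (use M LE sizeL in auto)
  then show ?thesis by (rule has_matching_mono) auto
qed

section \<open>Monomial ideals\<close>

lemma mpoly_ring_simps [simp]:
  "carrier (mpoly_ring :: ('v, 'k::field) mpoly ring) = UNIV"
  "x \<otimes>\<^bsub>(mpoly_ring :: ('v, 'k) mpoly ring)\<^esub> y = x * y"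
  "x \<oplus>\<^bsub>(mpoly_ring :: ('v, 'k) mpoly ring)\<^esub> y = x + y"
  "\<one>\<^bsub>(mpoly_ring :: ('v, 'k) mpoly ring)\<^esub> = 1"
  "\<zero>\<^bsub>(mpoly_ring :: ('v, 'k) mpoly ring)\<^esub> = 0"
  by (simp_all add: ring_of_type_algebra_def)

definition upward_closed :: "(('v \<Rightarrow> nat) \<Rightarrow> bool) \<Rightarrow> bool"
  where "upward_closed Q \<longleftrightarrow> (\<forall>b c. Q b \<longrightarrow> (\<forall>i. b i \<le> c i) \<longrightarrow> Q c)"

text \<open>For upward closed \<open>Q\<close> this is a monomial ideal. Membership is decided on
  exponents alone, which is how matchings enter.\<close>

definition monomial_span :: "(('v \<Rightarrow> nat) \<Rightarrow> bool) \<Rightarrow> ('v, 'k::field) mpoly set"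
  where "monomial_span Q = {f. \<forall>m\<in>Poly_Mapping.keys f. Q (Poly_Mapping.lookup m)}"

abbreviation monomial :: "('v \<Rightarrow>\<^sub>0 nat) \<Rightarrow> ('v, 'k::field) mpoly"
  where "monomial m \<equiv> Poly_Mapping.single m 1"

lemma upward_closedD: "upward_closed Q \<Longrightarrow> Q b \<Longrightarrow> (\<And>i. b i \<le> c i) \<Longrightarrow> Q c"
  by (auto simp: upward_closed_def)

lemma monomial_in_span [simp]: "monomial m \<in> monomial_span Q \<longleftrightarrow> Q (Poly_Mapping.lookup m)"
  by (simp add: monomial_span_def)

lemma mpoly_eq_sum:
  "f = (\<Sum>m\<in>Poly_Mapping.keys f. Poly_Mapping.single m (Poly_Mapping.lookup f m))"
  by (rule poly_mapping_eqI)
    (auto simp: lookup_sum lookup_single when_def in_keys_iff)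

text \<open>Only one pair of terms contributes to this coefficient, so nothing can cancel.\<close>

lemma lookup_mult_unique:
  fixes f g :: "'a::monoid_add \<Rightarrow>\<^sub>0 'b::semiring_0"
  assumes "m \<in> Poly_Mapping.keys f" "n \<in> Poly_Mapping.keys g"
    and unique: "\<And>p q. p \<in> Poly_Mapping.keys f \<Longrightarrow> q \<in> Poly_Mapping.keys g \<Longrightarrow> p + q = m + n \<Longrightarrow> p = m \<and> q = n"
  shows "Poly_Mapping.lookup (f * g) (m + n) = Poly_Mapping.lookup f m * Poly_Mapping.lookup g n"
proof -
  have "f * g = (\<Sum>p\<in>Poly_Mapping.keys f. \<Sum>q\<in>Poly_Mapping.keys g.
      Poly_Mapping.single (p + q) (Poly_Mapping.lookup f p * Poly_Mapping.lookup g q))"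
    by (subst (1) mpoly_eq_sum[of f], subst (1) mpoly_eq_sum[of g]) (simp add: sum_product mult_single)
  then have "Poly_Mapping.lookup (f * g) (m + n) =
      (\<Sum>p\<in>Poly_Mapping.keys f. \<Sum>q\<in>Poly_Mapping.keys g.
        if p + q = m + n then Poly_Mapping.lookup f p * Poly_Mapping.lookup g q else 0)"
    by (simp add: lookup_sum lookup_single when_def)
  also have "\<dots> = (\<Sum>p\<in>Poly_Mapping.keys f. \<Sum>q\<in>Poly_Mapping.keys g.
      if p = m then if q = n then Poly_Mapping.lookup f m * Poly_Mapping.lookup g n else 0 else 0)"
    using unique by (intro sum.cong refl) auto
  also have "\<dots> = (\<Sum>p\<in>Poly_Mapping.keys f.
      if p = m then Poly_Mapping.lookup f m * Poly_Mapping.lookup g n else 0)"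
    using assms(2) by (intro sum.cong) auto
  also have "\<dots> = Poly_Mapping.lookup f m * Poly_Mapping.lookup g n" using assms(1) by simp
  finally show ?thesis .
qed

lemma keys_monomial_mult:
  fixes f :: "('v, 'k::field) mpoly"
  shows "Poly_Mapping.keys (monomial c * f) = (+) c ` Poly_Mapping.keys f"
proof
  show "Poly_Mapping.keys (monomial c * f) \<subseteq> (+) c ` Poly_Mapping.keys f"
    using keys_mult[of "monomial c" f] by auto
  have "Poly_Mapping.lookup (monomial c * f) (c + m) = Poly_Mapping.lookup f m"
    if "m \<in> Poly_Mapping.keys f" for m
    using lookup_mult_unique[of c "monomial c" m f] that by simp
  then show "(+) c ` Poly_Mapping.keys f \<subseteq> Poly_Mapping.keys (monomial c * f)"
    by (auto simp: in_keys_iff)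
qed

lemma monomial_span_ideal:
  assumes Q: "upward_closed Q"
  shows "ideal (monomial_span Q :: ('v, 'k::field) mpoly set) mpoly_ring"
proof -
  let ?I = "monomial_span Q :: ('v, 'k) mpoly set"
  interpret R: cring "mpoly_ring :: ('v, 'k) mpoly ring" by (rule cring_from_type_algebra)
  have inv: "\<ominus>\<^bsub>(mpoly_ring :: ('v, 'k) mpoly ring)\<^esub> x = - x" for x
    by (rule R.minus_equality) auto
  have mult: "x * y \<in> ?I" if "x \<in> ?I" for x y
  proof -
    have "Q (Poly_Mapping.lookup k)" if k: "k \<in> Poly_Mapping.keys (x * y)" for k
    proof -
      obtain m n where "k = m + n" "m \<in> Poly_Mapping.keys x" using keys_mult[of x y] k by blast
      then show ?thesis
        using upward_closedD[OF Q, of "Poly_Mapping.lookup m"] \<open>x \<in> ?I\<close>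
        by (auto simp: monomial_span_def lookup_add)
    qed
    then show ?thesis by (simp add: monomial_span_def)
  qed
  show ?thesis
  proof (rule idealI)
    show "subgroup ?I (add_monoid mpoly_ring)"
    proof (rule R.add.subgroupI)
      show "?I \<noteq> {}" by (auto simp: monomial_span_def intro!: exI[of _ 0])
      show "x \<oplus>\<^bsub>mpoly_ring\<^esub> y \<in> ?I" if "x \<in> ?I" "y \<in> ?I" for x y
        using that keys_add[of x y] by (auto simp: monomial_span_def)
    qed (auto simp: inv monomial_span_def in_keys_iff)
    show "x \<otimes>\<^bsub>mpoly_ring\<^esub> f \<in> ?I" "f \<otimes>\<^bsub>mpoly_ring\<^esub> x \<in> ?I" if "f \<in> ?I" for f x
      using mult[OF that, of x] by (simp_all add: mult.commute)
  qed (rule R.ring_axioms)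
qed

lemma monomial_span_subset_ideal:
  fixes J :: "('v, 'k::field) mpoly set"
  assumes J: "ideal J mpoly_ring" and Q: "\<And>m. Q (Poly_Mapping.lookup m) \<Longrightarrow> monomial m \<in> J"
  shows "monomial_span Q \<subseteq> J"
proof
  interpret J: ideal J mpoly_ring by fact
  fix f :: "('v, 'k) mpoly" assume f: "f \<in> monomial_span Q"
  have "(\<Sum>m\<in>A. Poly_Mapping.single m (Poly_Mapping.lookup f m)) \<in> J"
    if "finite A" "A \<subseteq> Poly_Mapping.keys f" for A
    using that
  proof (induction A)
    case empty
    show ?case using additive_subgroup.zero_closed[OF ideal.axioms(1)[OF J]] by simp
  next
    case (insert m A)
    have "monomial m \<in> J" using insert.prems f Q by (auto simp: monomial_span_def)
    then have "Poly_Mapping.single 0 (Poly_Mapping.lookup f m) * monomial m \<in> J"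
      using J.I_l_closed unfolding mpoly_ring_simps by blast
    then have "Poly_Mapping.single m (Poly_Mapping.lookup f m) \<in> J" by (simp add: mult_single)
    then show ?case using insert additive_subgroup.a_closed[OF ideal.axioms(1)[OF J]] by simp
  qed
  from this[of "Poly_Mapping.keys f"] show "f \<in> J" using mpoly_eq_sum[of f] by simp
qed

lemma genideal_monomials:
  "genideal mpoly_ring (monomial ` A) =
    (monomial_span (\<lambda>b. \<exists>m\<in>A. \<forall>i. Poly_Mapping.lookup m i \<le> b i) :: ('v::finite, 'k::field) mpoly set)"
  (is "?I = monomial_span ?Q")
proof
  interpret R: cring "mpoly_ring :: ('v, 'k) mpoly ring" by (rule cring_from_type_algebra)
  have "upward_closed ?Q" unfolding upward_closed_def by (meson order_trans)
  then show "?I \<subseteq> monomial_span ?Q"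
    by (intro R.genideal_minimal monomial_span_ideal) auto
  have I: "ideal ?I mpoly_ring" by (rule R.genideal_ideal) simp
  interpret I: ideal ?I mpoly_ring by (rule I)
  show "monomial_span ?Q \<subseteq> ?I"
  proof (rule monomial_span_subset_ideal[OF I])
    fix n :: "'v \<Rightarrow>\<^sub>0 nat" assume "\<exists>m\<in>A. \<forall>i. Poly_Mapping.lookup m i \<le> Poly_Mapping.lookup n i"
    then obtain m where m: "m \<in> A" "\<And>i. Poly_Mapping.lookup m i \<le> Poly_Mapping.lookup n i" by blast
    \<comment> \<open>The componentwise order is divisibility, and \<open>n - m\<close> is the
      exponent of the cofactor.\<close>
    have "n = (n - m) + m" by (rule poly_mapping_eqI) (simp add: lookup_add lookup_minus m)
    then have "(monomial n :: ('v, 'k) mpoly) = monomial (n - m) * monomial m"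
      by (simp add: mult_single)
    moreover have "(monomial m :: ('v, 'k) mpoly) \<in> ?I"
      using R.genideal_self[of "monomial ` A"] m by auto
    ultimately show "(monomial n :: ('v, 'k) mpoly) \<in> ?I" using I.I_l_closed unfolding mpoly_ring_simps by simp
  qed
qed

section \<open>Variable ideals and powers of the edge ideal\<close>

lemma variable_ideal_eq:
  "(variable_ideal F :: ('v::finite, 'k::field) mpoly set) = monomial_span (\<lambda>b. \<exists>i\<in>F. 0 < b i)"
proof -
  have *: "(\<forall>j. Poly_Mapping.lookup (Poly_Mapping.single i (1::nat)) j \<le> b j) \<longleftrightarrow> 0 < b i" for i :: 'v and b
    by (auto simp: lookup_single when_def Suc_le_eq)
  define A where "A = (\<lambda>i. Poly_Mapping.single i (1::nat)) ` F"
  have "var ` F = (monomial ` A :: ('v, 'k) mpoly set)"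
    by (simp add: A_def var_def[abs_def] image_image)
  moreover have "(\<exists>m\<in>A. \<forall>j. Poly_Mapping.lookup m j \<le> b j) \<longleftrightarrow> (\<exists>i\<in>F. 0 < b i)" for b
    unfolding A_def using * by simp
  ultimately show ?thesis unfolding variable_ideal_def by (simp add: genideal_monomials)
qed

lemma edge_ideal_eq:
  fixes E :: "'v::finite set set"
  assumes E: "\<forall>e\<in>E. card e = 2"
  shows "(edge_ideal E :: ('v, 'k::field) mpoly set) = monomial_span (\<lambda>b. has_matching E b 1)"
proof -
  define A where "A = {Poly_Mapping.single i (1::nat) + Poly_Mapping.single j 1 | i j. {i, j} \<in> E}"
  have "{var i * var j | i j. {i, j} \<in> E} = (monomial ` A :: ('v, 'k) mpoly set)"
    by (auto simp: A_def var_def mult_single)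
  then have "(edge_ideal E :: ('v, 'k) mpoly set) =
      monomial_span (\<lambda>b. \<exists>m\<in>A. \<forall>i. Poly_Mapping.lookup m i \<le> b i)"
    unfolding edge_ideal_def by (simp add: genideal_monomials)
  moreover have "(\<exists>m\<in>A. \<forall>i. Poly_Mapping.lookup m i \<le> b i) \<longleftrightarrow> has_matching E b 1" for b
  proof
    assume "\<exists>m\<in>A. \<forall>i. Poly_Mapping.lookup m i \<le> b i"
    then obtain i j where ij: "{i, j} \<in> E"
      and le: "\<And>x. Poly_Mapping.lookup (Poly_Mapping.single i (1::nat) + Poly_Mapping.single j 1) x \<le> b x"
      by (auto simp: A_def)
    have "i \<noteq> j" using E ij by auto
    have "mdeg {#{i, j}#} x \<le> b x" for x
      using le[of x] \<open>i \<noteq> j\<close> by (auto simp: lookup_add lookup_single when_def split: if_splits)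
    then show "has_matching E b 1" using ij by (intro has_matchingI[of "{#{i, j}#}"]) auto
  next
    assume "has_matching E b 1"
    then obtain M where M: "set_mset M \<subseteq> E" "size M = 1" "\<And>i. mdeg M i \<le> b i"
      by (auto elim: has_matchingE)
    then obtain e where e: "M = {#e#}" using size_1_singleton_mset[OF M(2)] by blast
    then have "e \<in> E" using M by simp
    then have "card e = 2" using E by blast
    then obtain i j where ij: "e = {i, j}" "i \<noteq> j" by (auto simp: card_2_iff)
    show "\<exists>m\<in>A. \<forall>i. Poly_Mapping.lookup m i \<le> b i"
    proof
      show "Poly_Mapping.single i (1::nat) + Poly_Mapping.single j 1 \<in> A"
        using \<open>e \<in> E\<close> ij by (auto simp: A_def)
      show "\<forall>x. Poly_Mapping.lookup (Poly_Mapping.single i (1::nat) + Poly_Mapping.single j 1) x \<le> b x"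
      proof
        fix x show "Poly_Mapping.lookup (Poly_Mapping.single i (1::nat) + Poly_Mapping.single j 1) x \<le> b x"
          using M(3)[of x] e ij by (auto simp: lookup_add lookup_single when_def)
      qed
    qed
  qed
  ultimately show ?thesis by simp
qed

lemma ideal_prod_monomial_span:
  assumes P: "upward_closed P" and Q: "upward_closed Q"
  shows "ideal_prod mpoly_ring (monomial_span P) (monomial_span Q) =
    (monomial_span (\<lambda>b. \<exists>p q. P p \<and> Q q \<and> b = (\<lambda>i. p i + q i)) :: ('v::finite, 'k::field) mpoly set)"
  (is "?I = monomial_span ?S")
proof
  interpret R: cring "mpoly_ring :: ('v, 'k) mpoly ring" by (rule cring_from_type_algebra)
  show "?I \<subseteq> monomial_span ?S"
  proof
    fix f assume "f \<in> ?I"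
    then show "f \<in> monomial_span ?S"
    proof induction
      case (prod i j)
      show ?case unfolding monomial_span_def
      proof safe
        fix k assume "k \<in> Poly_Mapping.keys (i \<otimes>\<^bsub>mpoly_ring\<^esub> j)"
        then obtain m n where "k = m + n" "m \<in> Poly_Mapping.keys i" "n \<in> Poly_Mapping.keys j"
          using keys_mult[of i j] by auto
        then show "?S (Poly_Mapping.lookup k)"
          using prod by (intro exI[of _ "Poly_Mapping.lookup m"] exI[of _ "Poly_Mapping.lookup n"])
            (auto simp: monomial_span_def lookup_add)
      qed
    next
      case (sum s1 s2)
      then show ?case using keys_add[of s1 s2] unfolding monomial_span_def by auto
    qed
  qed
  have I: "ideal ?I mpoly_ring"
    by (intro R.ideal_prod_is_ideal monomial_span_ideal assms)
  show "monomial_span ?S \<subseteq> ?I"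
  proof (rule monomial_span_subset_ideal[OF I])
    fix m :: "'v \<Rightarrow>\<^sub>0 nat" assume "?S (Poly_Mapping.lookup m)"
    then obtain p q where pq: "P p" "Q q" "Poly_Mapping.lookup m = (\<lambda>i. p i + q i)" by blast
    \<comment> \<open>As \<open>'v\<close> is finite, every function is the exponent of a
      monomial.\<close>
    let ?p = "Poly_Mapping.Abs_poly_mapping p" and ?q = "Poly_Mapping.Abs_poly_mapping q"
    have l: "Poly_Mapping.lookup ?p = p" "Poly_Mapping.lookup ?q = q" by simp_all
    have "m = ?p + ?q" by (rule poly_mapping_eqI) (simp add: lookup_add pq)
    then have "(monomial m :: ('v, 'k) mpoly) = monomial ?p \<otimes>\<^bsub>mpoly_ring\<^esub> monomial ?q"
      by (simp add: mult_single)
    also have "\<dots> \<in> ?I" by (rule ideal_prod.prod) (simp_all add: pq l)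
    finally show "(monomial m :: ('v, 'k) mpoly) \<in> ?I" .
  qed
qed

lemma upward_closed_has_matching: "upward_closed (\<lambda>b. has_matching E b t)"
  unfolding upward_closed_def by (intro allI impI) (erule has_matching_mono, auto)

text \<open>One edge is split off: \<open>p\<close> is what the other \<open>t\<close> edges use,
  and \<open>q\<close> takes all remaining capacity. This mirrors
  \<open>I^(t+1) = I^t I\<close>.\<close>

lemma has_matching_Suc_iff:
  "has_matching E b (Suc t) \<longleftrightarrow>
    (\<exists>p q. has_matching E p t \<and> has_matching E q 1 \<and> b = (\<lambda>i. p i + q i))"
proof
  assume "has_matching E b (Suc t)"
  then obtain M where M: "set_mset M \<subseteq> E" "size M = Suc t" "\<And>i. mdeg M i \<le> b i"
    by (auto elim: has_matchingE)
  then obtain e N where e: "M = add_mset e N" by (metis size_eq_Suc_imp_eq_union)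
  have "has_matching E (mdeg N) t" using M e by (intro has_matchingI[of N]) auto
  moreover have "has_matching E (\<lambda>i. b i - mdeg N i) 1"
  proof (rule has_matchingI[of "{#e#}"])
    show "mdeg {#e#} i \<le> b i - mdeg N i" for i using M(3)[of i] e by simp
  qed (use M e in auto)
  moreover have "b = (\<lambda>i. mdeg N i + (b i - mdeg N i))"
  proof
    show "b i = mdeg N i + (b i - mdeg N i)" for i using M(3)[of i] e by simp
  qed
  ultimately show "\<exists>p q. has_matching E p t \<and> has_matching E q 1 \<and> b = (\<lambda>i. p i + q i)" by blast
next
  assume "\<exists>p q. has_matching E p t \<and> has_matching E q 1 \<and> b = (\<lambda>i. p i + q i)"
  then obtain p q where pq: "has_matching E p t" "has_matching E q 1" "b = (\<lambda>i. p i + q i)" by blast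
  obtain M where M: "set_mset M \<subseteq> E" "size M = t" "\<And>i. mdeg M i \<le> p i"
    using has_matchingE[OF pq(1)] by metis
  obtain N where N: "set_mset N \<subseteq> E" "size N = 1" "\<And>i. mdeg N i \<le> q i"
    using has_matchingE[OF pq(2)] by metis
  show "has_matching E b (Suc t)"
    by (rule has_matchingI[of "M + N"]) (use M N pq(3) in \<open>auto intro: add_mono\<close>)
qed

lemma edge_ideal_power_eq:
  fixes E :: "'v::finite set set"
  assumes E: "\<forall>e\<in>E. card e = 2"
  shows "ideal_power mpoly_ring (edge_ideal E) t =
    (monomial_span (\<lambda>b. has_matching E b t) :: ('v, 'k::field) mpoly set)"
proof (induction t)
  case 0
  have "has_matching E b 0" for b by (intro has_matchingI[of "{#}"]) auto
  then show ?case
    by (simp add: ideal_power_def nat_pow_def ideals_set_def monomial_span_def)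
next
  case (Suc t)
  have "ideal_power mpoly_ring (edge_ideal E) (Suc t) =
      ideal_prod mpoly_ring (ideal_power mpoly_ring (edge_ideal E) t)
        (edge_ideal E :: ('v, 'k) mpoly set)"
    by (simp add: ideal_power_def nat_pow_def ideals_set_def)
  also have "\<dots> = ideal_prod mpoly_ring (monomial_span (\<lambda>b. has_matching E b t))
      (monomial_span (\<lambda>b. has_matching E b 1))"
    by (simp only: Suc.IH) (simp only: edge_ideal_eq[OF E])
  also have "\<dots> = monomial_span (\<lambda>b. has_matching E b (Suc t))"
    by (simp only: ideal_prod_monomial_span[OF upward_closed_has_matching upward_closed_has_matching]
        has_matching_Suc_iff[symmetric])
  finally show ?case .
qed

text \<open>
  Strict convexity of the Euclidean norm: a longest vector of \<open>A + B\<close> is a sum of elements of \<open>A\<close> and \<open>B\<close> in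
  only one way. This replaces the leading monomials of a term order in the primality proof below.
\<close>

lemma eq_of_same_sum:
  fixes m n p q :: "'v::finite \<Rightarrow>\<^sub>0 nat"
  assumes "p + q = m + n"
    and "(\<Sum>i\<in>UNIV. (Poly_Mapping.lookup (m + q) i)\<^sup>2) \<le> (\<Sum>i\<in>UNIV. (Poly_Mapping.lookup (m + n) i)\<^sup>2)"
    and "(\<Sum>i\<in>UNIV. (Poly_Mapping.lookup (p + n) i)\<^sup>2) \<le> (\<Sum>i\<in>UNIV. (Poly_Mapping.lookup (m + n) i)\<^sup>2)"
  shows "p = m \<and> q = n"
proof -
  let ?x = "\<lambda>i. int (Poly_Mapping.lookup (m + q) i)" and ?y = "\<lambda>i. int (Poly_Mapping.lookup (p + n) i)"
    and ?v = "\<lambda>i. int (Poly_Mapping.lookup (m + n) i)"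
  have sum: "Poly_Mapping.lookup p i + Poly_Mapping.lookup q i = Poly_Mapping.lookup m i + Poly_Mapping.lookup n i" for i
    using assms(1) by (metis lookup_add)
  have xy: "?x i + ?y i = 2 * ?v i" for i using sum[of i] by (simp add: lookup_add)
  \<comment> \<open>Parallelogram identity for \<open>?x\<close> and \<open>?y\<close> with midpoint
    \<open>?v\<close>: neither is longer than \<open>?v\<close>, so they coincide.\<close>
  have "(\<Sum>i\<in>UNIV. (?x i - ?y i)\<^sup>2) = (\<Sum>i\<in>UNIV. 2 * (?x i)\<^sup>2 + 2 * (?y i)\<^sup>2 - 4 * (?v i)\<^sup>2)"
  proof (rule sum.cong)
    fix i
    have "4 * (?v i)\<^sup>2 = (?x i + ?y i)\<^sup>2" unfolding xy by (simp add: power2_eq_square)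
    then show "(?x i - ?y i)\<^sup>2 = 2 * (?x i)\<^sup>2 + 2 * (?y i)\<^sup>2 - 4 * (?v i)\<^sup>2"
      by (simp add: power2_eq_square algebra_simps)
  qed simp
  also have "\<dots> = 2 * (\<Sum>i\<in>UNIV. (?x i)\<^sup>2) + 2 * (\<Sum>i\<in>UNIV. (?y i)\<^sup>2) - 4 * (\<Sum>i\<in>UNIV. (?v i)\<^sup>2)"
    by (simp add: sum.distrib sum_subtractf sum_distrib_left)
  also have "\<dots> \<le> 0"
  proof -
    have "(\<Sum>i\<in>UNIV. (?x i)\<^sup>2) \<le> (\<Sum>i\<in>UNIV. (?v i)\<^sup>2)" "(\<Sum>i\<in>UNIV. (?y i)\<^sup>2) \<le> (\<Sum>i\<in>UNIV. (?v i)\<^sup>2)"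
      using assms(2,3) by (simp_all flip: of_nat_power of_nat_sum)
    then show ?thesis by linarith
  qed
  finally have "(\<Sum>i\<in>UNIV. (?x i - ?y i)\<^sup>2) = 0" by (simp add: antisym sum_nonneg)
  then have eq: "?x i = ?y i" for i by (simp add: sum_nonneg_eq_0_iff)
  then have "Poly_Mapping.lookup q i = Poly_Mapping.lookup n i \<and> Poly_Mapping.lookup p i = Poly_Mapping.lookup m i" for i
    using eq[of i] sum[of i] unfolding lookup_add by linarith
  then show ?thesis by (simp add: poly_mapping_eq_iff fun_eq_iff)
qed

lemma variable_ideal_prime:
  "primeideal (variable_ideal F :: ('v::finite, 'k::field) mpoly set) mpoly_ring"
proof -
  let ?Q = "\<lambda>b :: 'v \<Rightarrow> nat. \<exists>i\<in>F. 0 < b i"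
  interpret R: cring "mpoly_ring :: ('v, 'k) mpoly ring" by (rule cring_from_type_algebra)
  have "primeideal (monomial_span ?Q :: ('v, 'k) mpoly set) mpoly_ring"
  proof (rule primeidealI)
    have "upward_closed ?Q" unfolding upward_closed_def by (meson less_le_trans)
    then show "ideal (monomial_span ?Q :: ('v, 'k) mpoly set) mpoly_ring" by (rule monomial_span_ideal)
    have "(1 :: ('v, 'k) mpoly) \<notin> monomial_span ?Q" by (simp add: monomial_span_def)
    then show "carrier mpoly_ring \<noteq> (monomial_span ?Q :: ('v, 'k) mpoly set)" by auto
    fix f g :: "('v, 'k) mpoly"
    assume fg: "f \<otimes>\<^bsub>mpoly_ring\<^esub> g \<in> monomial_span ?Q"
    show "f \<in> monomial_span ?Q \<or> g \<in> monomial_span ?Q"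
    proof (rule ccontr)
      assume neither: "\<not> ?thesis"
      \<comment> \<open>These are the terms free of the variables of \<open>F\<close>. A longest sum
        of two such exponents arises only once, so its term survives in
        \<open>f * g\<close>.\<close>
      define A where "A = {m \<in> Poly_Mapping.keys f. \<forall>i\<in>F. Poly_Mapping.lookup m i = 0}"
      define B where "B = {m \<in> Poly_Mapping.keys g. \<forall>i\<in>F. Poly_Mapping.lookup m i = 0}"
      let ?h = "\<lambda>(m, n). \<Sum>i\<in>UNIV. (Poly_Mapping.lookup (m + n) i)\<^sup>2"
      have "A \<times> B \<noteq> {}" "finite (A \<times> B)"
        using neither by (auto simp: A_def B_def monomial_span_def)
      then have "Max (?h ` (A \<times> B)) \<in> ?h ` (A \<times> B)" and max: "\<forall>x\<in>A \<times> B. ?h x \<le> Max (?h ` (A \<times> B))"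
        by simp_all
      then obtain m n where mn: "m \<in> A" "n \<in> B" "Max (?h ` (A \<times> B)) = ?h (m, n)" by auto
      have "Poly_Mapping.lookup (f * g) (m + n) = Poly_Mapping.lookup f m * Poly_Mapping.lookup g n"
      proof (rule lookup_mult_unique)
        fix p q assume pq: "p \<in> Poly_Mapping.keys f" "q \<in> Poly_Mapping.keys g" "p + q = m + n"
        have "Poly_Mapping.lookup p i = 0 \<and> Poly_Mapping.lookup q i = 0" if "i \<in> F" for i
        proof -
          have "Poly_Mapping.lookup (p + q) i = 0"
            unfolding pq using mn that by (simp add: A_def B_def lookup_add)
          then show ?thesis by (simp add: lookup_add)
        qed
        then have "p \<in> A" "q \<in> B" using pq by (auto simp: A_def B_def)
        \<comment> \<open>The pairs \<open>(m, q)\<close> and \<open>(p, n)\<close> also lie in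
          \<open>A \<times> B\<close>, which yields the two length bounds.\<close>
        then show "p = m \<and> q = n"
          using max mn pq(3) by (intro eq_of_same_sum) force+
      qed (use mn in \<open>auto simp: A_def B_def\<close>)
      also have "\<dots> \<noteq> 0" using mn by (auto simp: A_def B_def in_keys_iff)
      finally have "m + n \<in> Poly_Mapping.keys (f * g)" by (simp add: in_keys_iff)
      then have "?Q (Poly_Mapping.lookup (m + n))" using fg by (auto simp: monomial_span_def)
      then show False using mn by (auto simp: A_def B_def lookup_add)
    qed
  qed (rule R.is_cring)
  then show ?thesis by (simp add: variable_ideal_eq)
qed

lemma variable_ideal_strict_mono:
  assumes "C \<subset> F"
  shows "(variable_ideal C :: ('v::finite, 'k::field) mpoly set) \<subset> variable_ideal F"
proof -
  obtain i where i: "i \<in> F" "i \<notin> C" using assms by blast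
  have "monomial (Poly_Mapping.single i 1) \<in> (variable_ideal F :: ('v, 'k) mpoly set)"
    using i by (auto simp: variable_ideal_eq intro!: bexI[of _ i])
  moreover have "monomial (Poly_Mapping.single i 1) \<notin> (variable_ideal C :: ('v, 'k) mpoly set)"
    using i by (auto simp: variable_ideal_eq lookup_single when_def)
  moreover have "(variable_ideal C :: ('v, 'k) mpoly set) \<subseteq> variable_ideal F"
    using assms by (force simp: variable_ideal_eq monomial_span_def)
  ultimately show ?thesis by blast
qed

section \<open>Associated primes of powers of edge ideals\<close>

text \<open>If \<open>P_F\<close> annihilates the class of \<open>f\<close>, some term of
  \<open>f\<close> gives a socle exponent. Otherwise each term would be killed by a monomial off
  \<open>F\<close>, and the product \<open>u\<close> of these monomials would kill \<open>f\<close>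
  without lying in \<open>P_F\<close>.\<close>

lemma associated_prime_monomial_span_iff:
  fixes F :: "'v::finite set"
  assumes Q: "upward_closed Q"
  shows "(variable_ideal F :: ('v, 'k::field) mpoly set) \<in> associated_primes mpoly_ring (monomial_span Q)
    \<longleftrightarrow> (\<exists>b. socle_exponent Q F b)"
proof
  assume "(variable_ideal F :: ('v, 'k) mpoly set) \<in> associated_primes mpoly_ring (monomial_span Q)"
  then obtain f where "(variable_ideal F :: ('v, 'k) mpoly set) = ideal_colon mpoly_ring (monomial_span Q) f"
    unfolding associated_primes_def by blast
  then have f: "r \<in> (variable_ideal F :: ('v, 'k) mpoly set) \<longleftrightarrow> r * f \<in> monomial_span Q" for r
    by (simp add: ideal_colon_def)
  have step: "Q ((Poly_Mapping.lookup m)(i := Suc (Poly_Mapping.lookup m i)))"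
    if "i \<in> F" "m \<in> Poly_Mapping.keys f" for i m
  proof -
    have "(monomial (Poly_Mapping.single i 1) :: ('v, 'k) mpoly) \<in> variable_ideal F"
      using that by (auto simp: variable_ideal_eq intro!: bexI[of _ i])
    then have "monomial (Poly_Mapping.single i 1) * f \<in> monomial_span Q"
      unfolding f .
    then have "Q (Poly_Mapping.lookup (Poly_Mapping.single i 1 + m))"
      using that by (auto simp: monomial_span_def keys_monomial_mult)
    moreover have "Poly_Mapping.lookup (Poly_Mapping.single i 1 + m) =
        (Poly_Mapping.lookup m)(i := Suc (Poly_Mapping.lookup m i))"
      by (auto simp: lookup_add lookup_single when_def)
    ultimately show ?thesis by simp
  qed
  show "\<exists>b. socle_exponent Q F b"
  proof (rule ccontr)
    assume none: "\<nexists>b. socle_exponent Q F b"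
    have "\<exists>c. (\<forall>i\<in>F. c i = 0) \<and> Q (\<lambda>i. Poly_Mapping.lookup m i + c i)"
      if "m \<in> Poly_Mapping.keys f" for m
    proof -
      have "\<not> socle_exponent Q F (Poly_Mapping.lookup m)" using none by blast
      with step[OF _ that] show ?thesis unfolding socle_exponent_def by blast
    qed
    then obtain c where "\<forall>m\<in>Poly_Mapping.keys f. (\<forall>i\<in>F. c m i = 0) \<and> Q (\<lambda>i. Poly_Mapping.lookup m i + c m i)"
      using bchoice[of "Poly_Mapping.keys f"
          "\<lambda>m c. (\<forall>i\<in>F. c i = 0) \<and> Q (\<lambda>i. Poly_Mapping.lookup m i + c i)"] by blast
    then have c0: "\<And>m i. m \<in> Poly_Mapping.keys f \<Longrightarrow> i \<in> F \<Longrightarrow> c m i = 0"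
      and c: "\<And>m. m \<in> Poly_Mapping.keys f \<Longrightarrow> Q (\<lambda>i. Poly_Mapping.lookup m i + c m i)"
      by blast+
    define u where "u = Poly_Mapping.Abs_poly_mapping (\<lambda>i. \<Sum>m\<in>Poly_Mapping.keys f. c m i)"
    have u: "Poly_Mapping.lookup u i = (\<Sum>m\<in>Poly_Mapping.keys f. c m i)" for i
      by (simp add: u_def)
    have "Q (Poly_Mapping.lookup (u + m))" if m: "m \<in> Poly_Mapping.keys f" for m
    proof (rule upward_closedD[of Q "\<lambda>i. Poly_Mapping.lookup m i + c m i", OF Q c[OF m]])
      fix i
      have "c m i \<le> (\<Sum>m\<in>Poly_Mapping.keys f. c m i)" using m by (intro member_le_sum) auto
      then show "Poly_Mapping.lookup m i + c m i \<le> Poly_Mapping.lookup (u + m) i"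
        by (simp add: lookup_add u)
    qed
    then have "monomial u * f \<in> monomial_span Q"
      by (auto simp: monomial_span_def keys_monomial_mult)
    then have "(monomial u :: ('v, 'k) mpoly) \<in> variable_ideal F" unfolding f .
    then obtain i where "i \<in> F" "0 < Poly_Mapping.lookup u i" by (auto simp: variable_ideal_eq)
    then show False using c0 u by simp
  qed
next
  assume "\<exists>b. socle_exponent Q F b"
  then obtain b where b: "socle_exponent Q F b" by blast
  define m where "m = Poly_Mapping.Abs_poly_mapping b"
  have m: "Poly_Mapping.lookup m = b" by (simp add: m_def)
  have "Q (Poly_Mapping.lookup (m + k)) \<longleftrightarrow> (\<exists>i\<in>F. 0 < Poly_Mapping.lookup k i)" for k
  proof
    assume "Q (Poly_Mapping.lookup (m + k))"
    then have "Q (\<lambda>i. b i + Poly_Mapping.lookup k i)" by (simp add: plus_poly_mapping.rep_eq m)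
    then have "\<not> (\<forall>i\<in>F. Poly_Mapping.lookup k i = 0)" using b by (auto simp: socle_exponent_def)
    then show "\<exists>i\<in>F. 0 < Poly_Mapping.lookup k i" by auto
  next
    assume "\<exists>i\<in>F. 0 < Poly_Mapping.lookup k i"
    then obtain i where i: "i \<in> F" "0 < Poly_Mapping.lookup k i" by blast
    then have "Q (b(i := Suc (b i)))" using b by (auto simp: socle_exponent_def)
    then show "Q (Poly_Mapping.lookup (m + k))"
      by (rule upward_closedD[OF Q]) (use i in \<open>auto simp: lookup_add m\<close>)
  qed
  then have "(variable_ideal F :: ('v, 'k) mpoly set) = ideal_colon mpoly_ring (monomial_span Q) (monomial m)"
    by (auto simp: ideal_colon_def variable_ideal_eq mult.commute[of _ "monomial m"])
      (auto simp: monomial_span_def keys_monomial_mult)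
  then show "(variable_ideal F :: ('v, 'k) mpoly set) \<in> associated_primes mpoly_ring (monomial_span Q)"
    using variable_ideal_prime[of F, where 'k = 'k] unfolding associated_primes_def by auto
qed

lemma embedded_associated_prime_iff:
  fixes E :: "'v::finite set set"
  assumes E: "\<forall>e\<in>E. card e = 2" and t: "1 \<le> t" and F: "cover E F" and core: "core E F \<noteq> {}"
  shows "(variable_ideal F :: ('v, 'k::field) mpoly set)
      \<in> embedded_associated_primes mpoly_ring (ideal_power mpoly_ring (edge_ideal E) t)
    \<longleftrightarrow> (\<exists>b. socle_exponent (\<lambda>b. has_matching E b t) F b)"
proof -
  note assoc = associated_prime_monomial_span_iff[OF upward_closed_has_matching[of E t], where 'k = 'k]
  obtain C where C: "C \<subset> F" "cover E C" "core E C = {}" using coreless_cover_exists[OF E F core] .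
  have "\<not> has_matching E (\<lambda>_. 0) t"
  proof
    assume "has_matching E (\<lambda>_. 0) t"
    then obtain M where M: "set_mset M \<subseteq> E" "size M = t" "\<And>i. mdeg M i \<le> 0"
      by (metis has_matchingE)
    then obtain e where e: "e \<in># M" using t by (metis not_one_le_zero size_empty multiset_nonemptyE)
    then have "e \<noteq> {}" using M(1) E by fastforce
    then show False using M(3) e mdeg_pos_iff[of M] by (metis ex_in_conv leD)
  qed
  \<comment> \<open>With an empty core, the zero exponent already meets all conditions.\<close>
  then have "\<exists>b. socle_exponent (\<lambda>b. has_matching E b t) C b"
    using socle_of_core_matching[OF E C(2), of "\<lambda>_. 0" t] C(3) by simp
  then have "(variable_ideal C :: ('v, 'k) mpoly set)
      \<in> associated_primes mpoly_ring (monomial_span (\<lambda>b. has_matching E b t))"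
    by (simp only: assoc)
  moreover have "(variable_ideal C :: ('v, 'k) mpoly set) \<subset> variable_ideal F"
    by (rule variable_ideal_strict_mono[OF C(1)])
  ultimately show ?thesis
    unfolding embedded_associated_primes_def edge_ideal_power_eq[OF E] using assoc[of F] by blast
qed

text \<open>For \<open>d \<ge> t\<close> both bounds hold trivially, so truncated subtraction may
  replace the integer difference.\<close>

lemma int_diff_le_iff: "int t - int d \<le> int x \<longleftrightarrow> t - d \<le> x"
  by arith

section \<open>Saturating graphs and the equivalence\<close>

lemma saturating_graph_of_iff:
  fixes E :: "'v::finite set set"
  assumes "simple_graph UNIV E"
  shows "saturating t (graph_of E a) \<longleftrightarrow> \<not> has_matching E a t \<and>
    (\<forall>i\<in>pos_verts a. has_matching E (\<lambda>j. if j \<in> nbhd_of E a i then 0 else a j) (t - degree_of E a i))"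
proof -
  have nbhd: "nbhd (graph_of E a) i = nbhd_of E a i" if "i \<in> pos_verts a" for i
    using that by (auto simp: nbhd_def nbhd_of_def graph_of_def)
  have "matching_number (graph_of E a) < t \<longleftrightarrow> \<not> has_matching E a t"
    using matching_number_ge_iff[OF assms, of t a] by (simp add: not_le[symmetric])
  moreover have "int (matching_number (remove_verts (graph_of E a) (nbhd (graph_of E a) i)))
        \<ge> int t - int (wdegree (graph_of E a) i) \<longleftrightarrow>
      has_matching E (\<lambda>j. if j \<in> nbhd_of E a i then 0 else a j) (t - degree_of E a i)"
    if "i \<in> pos_verts a" for i
  proof -
    have "wdegree (graph_of E a) i = degree_of E a i"
      by (simp add: wdegree_def nbhd[OF that] degree_of_def) (simp add: graph_of_def)
    then show ?thesis
      unfolding matching_number_remove_ge_iff[OF assms, symmetric] nbhd[OF that] by (simp add: int_diff_le_iff)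
  qed
  ultimately show ?thesis by (simp add: saturating_def) (simp add: graph_of_def)
qed

theorem theorem2p4:
  fixes E :: "'v::finite set set" and F :: "'v set" and t :: nat
  assumes "simple_graph UNIV E"
    and "t \<ge> 1"
    and "cover E F"
    and "core E F \<noteq> {}"
  shows "(variable_ideal F :: ('v, 'k::field) mpoly set)
            \<in> embedded_associated_primes mpoly_ring (ideal_power mpoly_ring (edge_ideal E) t)
      \<longleftrightarrow>
        (\<exists>a :: 'v \<Rightarrow> nat.
            minimal_cover_containing E (closed_nbhd E (pos_verts a)) F
          \<and> saturating t (graph_of E a)
          \<and> (\<forall>i \<in> core E F - pos_verts a.
                int (matching_number (remove_verts (graph_of E a) (nbhd_of E a i)))
                  \<ge> int t - int (degree_of E a i)))"
proof -
  have E: "\<forall>e\<in>E. card e = 2" using assms(1) by (auto simp: simple_graph_def)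
  let ?local = "\<lambda>a i. has_matching E (\<lambda>j. if j \<in> nbhd_of E a i then 0 else a j) (t - degree_of E a i)"
  have local: "int (matching_number (remove_verts (graph_of E a) (nbhd_of E a i)))
      \<ge> int t - int (degree_of E a i) \<longleftrightarrow> ?local a i" for a i
    unfolding matching_number_remove_ge_iff[OF assms(1), symmetric] by (rule int_diff_le_iff)
  show ?thesis
    unfolding embedded_associated_prime_iff[OF E assms(2-4)] saturating_graph_of_iff[OF assms(1)] local
  proof
    assume "\<exists>b. socle_exponent (\<lambda>b. has_matching E b t) F b"
    then obtain b where "socle_exponent (\<lambda>b. has_matching E b t) F b" ..
    from core_matching_of_socle[OF E assms(3,4) this]
    obtain a where out: "\<And>i. i \<notin> core E F \<Longrightarrow> a i = 0" and no: "\<not> has_matching E a t"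
      and inc: "\<And>i. i \<in> core E F \<Longrightarrow> has_matching E (a(i := Suc (a i))) t"
      by (elim exE conjE) blast
    have pos: "pos_verts a \<subseteq> core E F" using out by (force simp: pos_verts_def)
    have "minimal_cover_containing E (closed_nbhd E (pos_verts a)) F"
      unfolding minimal_cover_containing_def
    proof (intro conjI)
      show "closed_nbhd E (pos_verts a) \<subseteq> F" using pos by (auto simp: closed_nbhd_def core_def)
      show "\<not> (\<exists>C\<subset>F. cover E C \<and> closed_nbhd E (pos_verts a) \<subseteq> C)"
      proof
        assume "\<exists>C\<subset>F. cover E C \<and> closed_nbhd E (pos_verts a) \<subseteq> C"
        then obtain C where C: "C \<subset> F" "cover E C" "closed_nbhd E (pos_verts a) \<subseteq> C" by blast
        then obtain i where i: "i \<in> F" "i \<notin> C" by blast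
        \<comment> \<open>An edge from \<open>i\<close> to a vertex outside \<open>F\<close> would
          not be met by \<open>C\<close>.\<close>
        have iK: "i \<in> core E F"
          using i C(1,2) by (fastforce simp: core_def cover_def)
        obtain k where k: "t = Suc k" using assms(2) by (cases t) auto
        \<comment> \<open>Increasing \<open>a\<close> at \<open>i\<close> creates a
          \<open>t\<close>-matching, so \<open>i\<close> has a neighbor in the support of
          \<open>a\<close> and must lie in \<open>C\<close>.\<close>
        obtain x where "{i, x} \<in> E" "0 < a x"
          using has_matching_inc[OF E inc[OF iK, unfolded k] no[unfolded k]] by blast
        then have "i \<in> closed_nbhd E (pos_verts a)"
          by (auto simp: closed_nbhd_def pos_verts_def insert_commute)
        then show False using C i by blast
      qed
    qed (rule assms(3))
    moreover have "?local a i" if "i \<in> core E F" for i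
      using has_matching_remove_nbhd[OF E inc[OF that]] .
    ultimately show "\<exists>a. minimal_cover_containing E (closed_nbhd E (pos_verts a)) F
        \<and> (\<not> has_matching E a t \<and> (\<forall>i\<in>pos_verts a. ?local a i))
        \<and> (\<forall>i\<in>core E F - pos_verts a. ?local a i)"
      using no pos by (intro exI[of _ a] conjI ballI) blast+
  next
    assume "\<exists>a. minimal_cover_containing E (closed_nbhd E (pos_verts a)) F
        \<and> (\<not> has_matching E a t \<and> (\<forall>i\<in>pos_verts a. ?local a i))
        \<and> (\<forall>i\<in>core E F - pos_verts a. ?local a i)"
    then obtain a where sub: "closed_nbhd E (pos_verts a) \<subseteq> F" and no: "\<not> has_matching E a t"
      and loc: "\<forall>i\<in>pos_verts a. ?local a i" "\<forall>i\<in>core E F - pos_verts a. ?local a i"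
      unfolding minimal_cover_containing_def by (elim exE conjE) blast
    \<comment> \<open>A neighbor outside \<open>F\<close> of a vertex in the support would belong to
      the closed neighborhood, hence to \<open>F\<close>.\<close>
    have "pos_verts a \<subseteq> core E F"
      using sub by (auto simp: closed_nbhd_def core_def)
    then have "a i = 0" if "i \<notin> core E F" for i using that by (auto simp: pos_verts_def)
    \<comment> \<open>The power \<open>m\<close> is \<open>degree_of E a i\<close>, one unit for
      each edge of the star at \<open>i\<close>.\<close>
    moreover have "\<exists>m. has_matching E (a(i := a i + m)) t" if "i \<in> core E F" for i
      using has_matching_of_remove_nbhd[OF E, of a i t] loc that by blast
    ultimately show "\<exists>b. socle_exponent (\<lambda>b. has_matching E b t) F b"
      using socle_of_core_matching[OF E assms(3) _ no] by blast
  qed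
qed

end
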